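(* Let $K$ be a field of characteristic $0$, $d\ge 2$, and let $\alpha_1,\alpha_2\in K$ satisfy $\alpha_1\alpha_2(\alpha_1+\alpha_2)(\alpha_1-\alpha_2)\neq0$. In $G_d(\mathfrak U_\alpha)$ the consequences of degree $n+1$ of the following polynomials of degree $n$ are equivalent to the polynomials listed: (i) for $w_{(1)}=x_1$: $w_{(2)}^{(1)}=y_1z_1$ and $w_{(1^2)}^{(0)}=y_1z_2-y_2z_1$; (ii) for $w_{(2)}^{(1)}=y_1z_1$: $w_{(3)}^{(2)}=y_1^2z_1$, $w_{(2,1)}^{(1)}$, $w_{(2,1)}^{(0)}$; (iii) for $w_{(1^2)}^{(0)}=y_1z_2-y_2z_1$: $w_{(3)}^{(2)}=y_1^2z_1$, $w_{(2,1)}^{(1)}$, $w_{(2,1)}^{(0)}$. Hence an identity of degree $1$ or $2$ implies, respectively, all polynomials of degree $2$ and $3$ in $G_d(\mathfrak U_\alpha)$. (iv) The polynomials $w_{(3)}^{(2)}$ and $\beta_1w_{(2,1)}^{(1)}+\beta_2w_{(2,1)}^{(0)}$, $(\beta_1,\beta_2)\neq(0,0)$, have no (nonzero) consequences of degree $4$.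
   Context: A bicommutative algebra is a nonassociative $K$-algebra satisfying $(x_1x_2)x_3=(x_1x_3)x_2$ and $x_1(x_2x_3)=x_2(x_1x_3)$; $\mathfrak B$ is the variety of all of them. The free bicommutative algebra $F_d(\mathfrak B)$ on $x_1,\dots,x_d$ is identified (via $x_i\mapsto x_i$) with the algebra $G_d$ having as basis $x_1,\dots,x_d$ together with all monomials $Y^aZ^b=y_1^{a_1}\cdots y_d^{a_d}z_1^{b_1}\cdots z_d^{b_d}$ in the polynomial algebra $K[y_1,\dots,y_d,z_1,\dots,z_d]$ with $|a|\ge1$ and $|b|\ge1$, and multiplication $x_ix_j=y_iz_j$, $x_i(Y^aZ^b)=y_iY^aZ^b$, $(Y^aZ^b)x_i=Y^aZ^bz_i$, $(Y^aZ^b)(Y^cZ^e)=Y^{a+c}Z^{b+e}$. The group $GL_d(K)$ acts on $G_d$ by automorphisms extending its linear action on the span of $x_1,\dots,x_d$. Put $w_{(1)}=x_1$, $w_{(n)}^{(j)}=y_1^jz_1^{n-j}$ ($1\le j\le n-1$), and $w_{(\lambda_1,\lambda_2)}^{(j)}=y_1^j(y_1z_2-y_2z_1)^{\lambda_2}z_1^{\lambda_1-\lambda_2-j}$ for $\lambda_2>0$, $0\le j\le\lambda_1-\lambda_2$; $(1^2)=(1,1)$. $\mathfrak U_\alpha$ is the variety of bicommutative algebras defined by the identity $\alpha_1x(xx)+\alpha_2(xx)x=0$, and $G_d(\mathfrak U_\alpha)\cong F_d(\mathfrak U_\alpha)$ is the factor algebra of $G_d$ modulo the T-ideal (ideal closed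 under all endomorphisms) generated by $\alpha_1y_1^2z_1+\alpha_2y_1z_1^2$; elements of $G_d$ denote also their images. For a homogeneous $f$ of degree $n$ in $G_d(\mathfrak U_\alpha)$, its consequences of degree $n+1$ are the elements of the degree $n+1$ homogeneous component of the T-ideal of $G_d(\mathfrak U_\alpha)$ generated by $f$ (one says $f$ implies these elements). They are "equivalent to" a list of polynomials if this component equals the $GL_d(K)$-submodule generated by the list. An "identity of degree $n$" is a nonzero homogeneous element of degree $n$ of $G_d(\mathfrak U_\alpha)$. *)

theory Defs
  imports "HOL-Library.Poly_Mapping" "HOL-Library.Product_Plus"
begin

section \<open>Nonassociative algebras, T-ideals and factor algebras\<close>

record ('k, 'a) nonassoc_algebra =
  carrier :: "'a set"
  zero :: "'a"
  add :: "'a \<Rightarrow> 'a \<Rightarrow> 'a"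
  scale :: "'k \<Rightarrow> 'a \<Rightarrow> 'a"
  mult :: "'a \<Rightarrow> 'a \<Rightarrow> 'a"

definition subspace_of :: "('k, 'a) nonassoc_algebra \<Rightarrow> 'a set \<Rightarrow> bool" where
  "subspace_of A M \<longleftrightarrow>
     M \<subseteq> carrier A \<and> zero A \<in> M \<and>
     (\<forall>x\<in>M. \<forall>y\<in>M. add A x y \<in> M) \<and>
     (\<forall>c. \<forall>x\<in>M. scale A c x \<in> M)"

definition ideal_of :: "('k, 'a) nonassoc_algebra \<Rightarrow> 'a set \<Rightarrow> bool" where
  "ideal_of A I \<longleftrightarrow>
     subspace_of A I \<and>
     (\<forall>x\<in>I. \<forall>a\<in>carrier A. mult A a x \<in> I \<and> mult A x a \<in> I)"

definition endomorphism_of :: "('k, 'a) nonassoc_algebra \<Rightarrow> ('a \<Rightarrow> 'a) \<Rightarrow> bool" where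
  "endomorphism_of A \<phi> \<longleftrightarrow>
     (\<forall>x\<in>carrier A. \<phi> x \<in> carrier A) \<and>
     (\<forall>x\<in>carrier A. \<forall>y\<in>carrier A. \<phi> (add A x y) = add A (\<phi> x) (\<phi> y)) \<and>
     (\<forall>c. \<forall>x\<in>carrier A. \<phi> (scale A c x) = scale A c (\<phi> x)) \<and>
     (\<forall>x\<in>carrier A. \<forall>y\<in>carrier A. \<phi> (mult A x y) = mult A (\<phi> x) (\<phi> y))"

definition T_ideal :: "('k, 'a) nonassoc_algebra \<Rightarrow> 'a set \<Rightarrow> bool" where
  "T_ideal A I \<longleftrightarrow> ideal_of A I \<and> (\<forall>\<phi>. endomorphism_of A \<phi> \<longrightarrow> \<phi> ` I \<subseteq> I)"

definition T_ideal_gen :: "('k, 'a) nonassoc_algebra \<Rightarrow> 'a set \<Rightarrow> 'a set" where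
  "T_ideal_gen A S = \<Inter>{I. T_ideal A I \<and> S \<subseteq> I}"

definition coset :: "('k, 'a) nonassoc_algebra \<Rightarrow> 'a set \<Rightarrow> 'a \<Rightarrow> 'a set" where
  "coset A I a = add A a ` I"

definition factor_algebra ::
    "('k, 'a) nonassoc_algebra \<Rightarrow> 'a set \<Rightarrow> ('k, 'a set) nonassoc_algebra" where
  "factor_algebra A I =
     \<lparr> carrier = coset A I ` carrier A,
       zero = I,
       add = (\<lambda>X Y. \<Union>x\<in>X. \<Union>y\<in>Y. coset A I (add A x y)),
       scale = (\<lambda>c X. \<Union>x\<in>X. coset A I (scale A c x)),
       mult = (\<lambda>X Y. \<Union>x\<in>X. \<Union>y\<in>Y. coset A I (mult A x y)) \<rparr>"

section \<open>The algebra \<open>G\<^sub>d\<close>\<close>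

text \<open>
  The exponent pair \<open>(a, b)\<close> stands for the monomial \<open>Y\<^sup>a Z\<^sup>b\<close>, so \<open>'k yz_poly\<close>
  is the polynomial algebra in the variables \<open>y\<^sub>i\<close>, \<open>z\<^sub>i\<close> (\<open>i\<close> a natural number).
  An element of \<open>G\<^sub>d\<close> is a pair \<open>(v, p)\<close> standing for
  \<open>\<Sum>\<^sub>i v\<^sub>i x\<^sub>i + p\<close>. The indices \<open>1, \<dots>, d\<close> are enforced by the carrier.
\<close>

type_synonym 'k yz_poly = "((nat \<Rightarrow>\<^sub>0 nat) \<times> (nat \<Rightarrow>\<^sub>0 nat)) \<Rightarrow>\<^sub>0 'k"

type_synonym 'k galg = "(nat \<Rightarrow>\<^sub>0 'k) \<times> 'k yz_poly"

definition Const :: "'k::field_char_0 \<Rightarrow> 'k yz_poly" where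
  "Const c = Poly_Mapping.single 0 c"

definition yv :: "nat \<Rightarrow> 'k::field_char_0 yz_poly" where
  "yv i = Poly_Mapping.single (Poly_Mapping.single i 1, 0) 1"

definition zv :: "nat \<Rightarrow> 'k::field_char_0 yz_poly" where
  "zv i = Poly_Mapping.single (0, Poly_Mapping.single i 1) 1"

definition gen :: "nat \<Rightarrow> 'k::field_char_0 galg" where
  "gen i = (Poly_Mapping.single i 1, 0)"

definition pol :: "'k::field_char_0 yz_poly \<Rightarrow> 'k galg" where
  "pol p = (0, p)"

definition mdeg :: "(nat \<Rightarrow>\<^sub>0 nat) \<Rightarrow> nat" where
  "mdeg a = (\<Sum>i\<in>Poly_Mapping.keys a. Poly_Mapping.lookup a i)"

definition G_carrier :: "nat \<Rightarrow> 'k::field_char_0 galg set" where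
  "G_carrier d =
     {(v, p). Poly_Mapping.keys v \<subseteq> {1..d} \<and>
        (\<forall>(a, b)\<in>Poly_Mapping.keys p.
           Poly_Mapping.keys a \<subseteq> {1..d} \<and> Poly_Mapping.keys b \<subseteq> {1..d} \<and>
           mdeg a \<ge> 1 \<and> mdeg b \<ge> 1)}"

definition gscale :: "'k::field_char_0 \<Rightarrow> 'k galg \<Rightarrow> 'k galg" where
  "gscale c f = (Poly_Mapping.map ((*) c) (fst f), Poly_Mapping.map ((*) c) (snd f))"

text \<open>
  A factor \<open>x\<^sub>i\<close> on the left acts as \<open>y\<^sub>i\<close>, on the right as \<open>z\<^sub>i\<close>, and
  monomials multiply as in the polynomial algebra. Hence the bilinear extension of the
  multiplication table is the product of the polynomials obtained by \<open>x\<^sub>i \<mapsto> y\<^sub>i\<close> in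
  the left factor and \<open>x\<^sub>i \<mapsto> z\<^sub>i\<close> in the right one; see \<open>gmul_table\<close> and
  \<open>gmul_bilinear\<close> below.
\<close>

definition left_poly :: "'k::field_char_0 galg \<Rightarrow> 'k yz_poly" where
  "left_poly f =
     (\<Sum>i\<in>Poly_Mapping.keys (fst f). Const (Poly_Mapping.lookup (fst f) i) * yv i) + snd f"

definition right_poly :: "'k::field_char_0 galg \<Rightarrow> 'k yz_poly" where
  "right_poly f =
     (\<Sum>i\<in>Poly_Mapping.keys (fst f). Const (Poly_Mapping.lookup (fst f) i) * zv i) + snd f"

definition gmul :: "'k::field_char_0 galg \<Rightarrow> 'k galg \<Rightarrow> 'k galg" where
  "gmul f g = pol (left_poly f * right_poly g)"

definition G :: "nat \<Rightarrow> ('k::field_char_0, 'k galg) nonassoc_algebra" where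
  "G d = \<lparr> carrier = G_carrier d, zero = 0, add = (+), scale = gscale, mult = gmul \<rparr>"

definition G_comp :: "nat \<Rightarrow> nat \<Rightarrow> 'k::field_char_0 galg set" where
  "G_comp d n =
     {(v, p) \<in> G_carrier d.
        (v \<noteq> 0 \<longrightarrow> n = 1) \<and> (\<forall>(a, b)\<in>Poly_Mapping.keys p. mdeg a + mdeg b = n)}"

section \<open>The action of the general linear group\<close>

definition GL :: "nat \<Rightarrow> (nat \<Rightarrow> nat \<Rightarrow> 'k::field_char_0) set" where
  "GL d = {g. \<exists>h. \<forall>i\<in>{1..d}. \<forall>j\<in>{1..d}.
      (\<Sum>k=1..d. g i k * h k j) = (if i = j then 1 else 0) \<and>
      (\<Sum>k=1..d. h i k * g k j) = (if i = j then 1 else 0)}"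

definition psubst ::
    "(nat \<Rightarrow> 'k::field_char_0 yz_poly) \<Rightarrow> (nat \<Rightarrow> 'k yz_poly) \<Rightarrow> 'k yz_poly \<Rightarrow> 'k yz_poly" where
  "psubst u v p =
     (\<Sum>(a, b)\<in>Poly_Mapping.keys p. Const (Poly_Mapping.lookup p (a, b)) *
        (\<Prod>i\<in>Poly_Mapping.keys a. u i ^ Poly_Mapping.lookup a i) *
        (\<Prod>i\<in>Poly_Mapping.keys b. v i ^ Poly_Mapping.lookup b i))"

text \<open>
  The matrix \<open>g\<close> acts by \<open>x\<^sub>j \<mapsto> \<Sum>\<^sub>i g\<^sub>i\<^sub>j x\<^sub>i\<close>; the automorphism of \<open>G\<^sub>d\<close> extending
  this applies the same substitution to the \<open>y\<^sub>j\<close> and to the \<open>z\<^sub>j\<close>; see \<open>gl_act_gen\<close>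
  and \<open>endomorphism_gl_act\<close> below.
\<close>

definition gl_act :: "nat \<Rightarrow> (nat \<Rightarrow> nat \<Rightarrow> 'k::field_char_0) \<Rightarrow> 'k galg \<Rightarrow> 'k galg" where
  "gl_act d g f =
     (\<Sum>j\<in>Poly_Mapping.keys (fst f). \<Sum>i=1..d.
         Poly_Mapping.single i (g i j * Poly_Mapping.lookup (fst f) j),
      psubst (\<lambda>j. \<Sum>i=1..d. Const (g i j) * yv i)
             (\<lambda>j. \<Sum>i=1..d. Const (g i j) * zv i) (snd f))"

section \<open>The relatively free algebra \<open>G\<^sub>d(U\<^sub>\<alpha>)\<close>\<close>

definition U_ideal :: "nat \<Rightarrow> 'k::field_char_0 \<Rightarrow> 'k \<Rightarrow> 'k galg set" where
  "U_ideal d \<alpha>\<^sub>1 \<alpha>\<^sub>2 =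
     T_ideal_gen (G d)
       {pol (Const \<alpha>\<^sub>1 * (yv 1)\<^sup>2 * zv 1 + Const \<alpha>\<^sub>2 * yv 1 * (zv 1)\<^sup>2)}"

definition GU :: "nat \<Rightarrow> 'k::field_char_0 \<Rightarrow> 'k \<Rightarrow> ('k, 'k galg set) nonassoc_algebra" where
  "GU d \<alpha>\<^sub>1 \<alpha>\<^sub>2 = factor_algebra (G d) (U_ideal d \<alpha>\<^sub>1 \<alpha>\<^sub>2)"

definition img :: "nat \<Rightarrow> 'k::field_char_0 \<Rightarrow> 'k \<Rightarrow> 'k galg \<Rightarrow> 'k galg set" where
  "img d \<alpha>\<^sub>1 \<alpha>\<^sub>2 f = coset (G d) (U_ideal d \<alpha>\<^sub>1 \<alpha>\<^sub>2) f"

definition GU_comp :: "nat \<Rightarrow> 'k::field_char_0 \<Rightarrow> 'k \<Rightarrow> nat \<Rightarrow> 'k galg set set" where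
  "GU_comp d \<alpha>\<^sub>1 \<alpha>\<^sub>2 n = img d \<alpha>\<^sub>1 \<alpha>\<^sub>2 ` G_comp d n"

definition consequences ::
    "nat \<Rightarrow> 'k::field_char_0 \<Rightarrow> 'k \<Rightarrow> nat \<Rightarrow> 'k galg set \<Rightarrow> 'k galg set set" where
  "consequences d \<alpha>\<^sub>1 \<alpha>\<^sub>2 m f = T_ideal_gen (GU d \<alpha>\<^sub>1 \<alpha>\<^sub>2) {f} \<inter> GU_comp d \<alpha>\<^sub>1 \<alpha>\<^sub>2 m"

text \<open>
  A matrix acts on the factor algebra by mapping a coset to its image: the ideal is
  mapped onto itself by every automorphism of \<open>G\<^sub>d\<close>.
\<close>

definition GL_submodule_gen ::
    "nat \<Rightarrow> 'k::field_char_0 \<Rightarrow> 'k \<Rightarrow> 'k galg set set \<Rightarrow> 'k galg set set" where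
  "GL_submodule_gen d \<alpha>\<^sub>1 \<alpha>\<^sub>2 S =
     \<Inter>{M. subspace_of (GU d \<alpha>\<^sub>1 \<alpha>\<^sub>2) M \<and> (\<forall>g\<in>GL d. \<forall>X\<in>M. gl_act d g ` X \<in> M) \<and> S \<subseteq> M}"

definition consequences_equivalent_to ::
    "nat \<Rightarrow> 'k::field_char_0 \<Rightarrow> 'k \<Rightarrow> nat \<Rightarrow> 'k galg \<Rightarrow> 'k galg set \<Rightarrow> bool" where
  "consequences_equivalent_to d \<alpha>\<^sub>1 \<alpha>\<^sub>2 m f L \<longleftrightarrow>
     consequences d \<alpha>\<^sub>1 \<alpha>\<^sub>2 m (img d \<alpha>\<^sub>1 \<alpha>\<^sub>2 f) =
     GL_submodule_gen d \<alpha>\<^sub>1 \<alpha>\<^sub>2 (img d \<alpha>\<^sub>1 \<alpha>\<^sub>2 ` L)"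

section \<open>The highest weight vectors\<close>

definition w1 :: "nat \<Rightarrow> nat \<Rightarrow> 'k::field_char_0 galg" where
  "w1 n j = pol (yv 1 ^ j * zv 1 ^ (n - j))"

definition w2 :: "nat \<Rightarrow> nat \<Rightarrow> nat \<Rightarrow> 'k::field_char_0 galg" where
  "w2 l\<^sub>1 l\<^sub>2 j =
     pol (yv 1 ^ j * (yv 1 * zv 2 - yv 2 * zv 1) ^ l\<^sub>2 * zv 1 ^ (l\<^sub>1 - l\<^sub>2 - j))"

section \<open>Basic properties of \<open>G\<^sub>d\<close> and of the action\<close>

lemma gmul_table:
  "gmul (gen i) (gen j) = pol (yv i * zv j)"
  "gmul (gen i) (pol p) = pol (yv i * p)"
  "gmul (pol p) (gen i) = pol (p * zv i)"
  "gmul (pol p) (pol q) = pol (p * q)"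
  by (simp_all add: gmul_def left_poly_def right_poly_def gen_def pol_def Const_def
      flip: zero_prod_def)

lemma sum_keys_add:
  fixes F :: "'a \<Rightarrow> 'k::field_char_0 \<Rightarrow> 'b::comm_monoid_add"
  assumes "\<And>k. F k 0 = 0" "\<And>k c e. F k (c + e) = F k c + F k e"
  shows "(\<Sum>k\<in>Poly_Mapping.keys (p + q). F k (Poly_Mapping.lookup (p + q) k)) =
     (\<Sum>k\<in>Poly_Mapping.keys p. F k (Poly_Mapping.lookup p k)) +
     (\<Sum>k\<in>Poly_Mapping.keys q. F k (Poly_Mapping.lookup q k))"
  by (rule setsum_keys_plus_distrib) (use assms in auto)

lemma lookup_map_scale:
  "Poly_Mapping.lookup (Poly_Mapping.map ((*) c) p) k = (c::'k::field_char_0) * Poly_Mapping.lookup p k"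
  by (simp add: map.rep_eq when_def)

lemma sum_keys_scale:
  fixes F :: "'a \<Rightarrow> 'k::field_char_0 \<Rightarrow> 'b::comm_monoid_add"
  assumes "\<And>k. F k 0 = 0"
  shows "(\<Sum>k\<in>Poly_Mapping.keys (Poly_Mapping.map ((*) c) p).
            F k (Poly_Mapping.lookup (Poly_Mapping.map ((*) c) p) k)) =
     (\<Sum>k\<in>Poly_Mapping.keys p. F k (c * Poly_Mapping.lookup p k))"
proof -
  have "Poly_Mapping.keys (Poly_Mapping.map ((*) c) p) \<subseteq> Poly_Mapping.keys p"
    by (auto simp: in_keys_iff lookup_map_scale)
  then show ?thesis
    by (intro sum.mono_neutral_cong_left)
       (auto simp: in_keys_iff lookup_map_scale assms)
qed

lemma Const_simps:
  "Const 0 = 0" "Const 1 = 1" "Const (c + e) = Const c + Const e" "Const (c * e) = Const c * Const e"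
  by (simp_all add: Const_def single_add mult_single flip: zero_prod_def)

lemma map_scale_eq: "Poly_Mapping.map ((*) c) p = Const c * p"
  by (simp add: Const_def mult_map_scale_conv_mult)

lemma left_poly_add: "left_poly (f + g) = left_poly f + left_poly g"
  unfolding left_poly_def fst_add snd_add
  by (subst sum_keys_add) (auto simp: Const_simps algebra_simps)

lemma right_poly_add: "right_poly (f + g) = right_poly f + right_poly g"
  unfolding right_poly_def fst_add snd_add
  by (subst sum_keys_add) (auto simp: Const_simps algebra_simps)

lemma left_poly_scale: "left_poly (gscale c f) = Const c * left_poly f"
  unfolding left_poly_def gscale_def fst_conv snd_conv map_scale_eq
  by (subst sum_keys_scale) (auto simp: Const_simps algebra_simps sum_distrib_left)

lemma right_poly_scale: "right_poly (gscale c f) = Const c * right_poly f"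
  unfolding right_poly_def gscale_def fst_conv snd_conv map_scale_eq
  by (subst sum_keys_scale) (auto simp: Const_simps algebra_simps sum_distrib_left)

lemma gscale_pol: "gscale c (pol p) = pol (Const c * p)"
  by (simp add: gscale_def pol_def map_scale_eq map_eq_zero_iff)

lemma pol_add: "pol (p + q) = pol p + pol q"
  by (simp add: pol_def)

lemma gmul_bilinear:
  "gmul (f + f') g = gmul f g + gmul f' g"
  "gmul f (g + g') = gmul f g + gmul f g'"
  "gmul (gscale c f) g = gscale c (gmul f g)"
  "gmul f (gscale c g) = gscale c (gmul f g)"
  by (simp_all add: gmul_def left_poly_add right_poly_add left_poly_scale right_poly_scale
      gscale_pol pol_add algebra_simps flip: pol_add)

lemma left_poly_pol [simp]: "left_poly (pol p) = p"
  and right_poly_pol [simp]: "right_poly (pol p) = p"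
  by (simp_all add: left_poly_def right_poly_def pol_def)

lemma gmul_bicommutative:
  "gmul (gmul f g) h = gmul (gmul f h) g"
  "gmul f (gmul g h) = gmul g (gmul f h)"
  by (simp_all add: gmul_def algebra_simps)

lemma U_generator_eq:
  "gscale \<alpha>\<^sub>1 (gmul (gen 1) (gmul (gen 1) (gen 1))) + gscale \<alpha>\<^sub>2 (gmul (gmul (gen 1) (gen 1)) (gen 1)) =
   pol (Const \<alpha>\<^sub>1 * (yv 1)\<^sup>2 * zv 1 + Const \<alpha>\<^sub>2 * yv 1 * (zv 1)\<^sup>2)"
  by (simp add: gmul_table gscale_pol pol_add power2_eq_square mult.assoc)

lemma poly_mapping_sum_single:
  "p = (\<Sum>k\<in>Poly_Mapping.keys p. Poly_Mapping.single k (Poly_Mapping.lookup p k))"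
  by (rule poly_mapping_eqI)
     (auto simp: lookup_sum lookup_single when_def sum.delta' in_keys_iff)

definition mon_subst :: "(nat \<Rightarrow> 'k::field_char_0 yz_poly) \<Rightarrow> (nat \<Rightarrow>\<^sub>0 nat) \<Rightarrow> 'k yz_poly" where
  "mon_subst u a = (\<Prod>i\<in>Poly_Mapping.keys a. u i ^ Poly_Mapping.lookup a i)"

lemma mon_subst_add: "mon_subst u (a + b) = mon_subst u a * mon_subst u b"
proof -
  let ?K = "Poly_Mapping.keys a \<union> Poly_Mapping.keys b"
  have *: "mon_subst u c = (\<Prod>i\<in>?K. u i ^ Poly_Mapping.lookup c i)"
    if "Poly_Mapping.keys c \<subseteq> ?K" for c
    unfolding mon_subst_def using that
    by (intro prod.mono_neutral_left) (auto simp: in_keys_iff)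
  show ?thesis
    using keys_add[of a b]
    by (simp add: * lookup_add power_add prod.distrib)
qed

lemma psubst_alt:
  "psubst u v p = (\<Sum>m\<in>Poly_Mapping.keys p.
     Const (Poly_Mapping.lookup p m) * mon_subst u (fst m) * mon_subst v (snd m))"
  by (simp add: psubst_def mon_subst_def split_def)

lemma psubst_add: "psubst u v (p + q) = psubst u v p + psubst u v q"
  unfolding psubst_alt
  by (subst sum_keys_add) (auto simp: Const_simps algebra_simps)

lemma psubst_zero [simp]: "psubst u v 0 = 0"
  by (simp add: psubst_def)

lemma psubst_sum: "psubst u v (\<Sum>i\<in>A. f i) = (\<Sum>i\<in>A. psubst u v (f i))"
  by (induction A rule: infinite_finite_induct) (auto simp: psubst_add)

lemma psubst_single:
  "psubst u v (Poly_Mapping.single m c) = Const c * mon_subst u (fst m) * mon_subst v (snd m)"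
  by (cases "c = 0") (auto simp: psubst_alt Const_simps)

lemma psubst_mult: "psubst u v (p * q) = psubst u v p * psubst u v q"
proof -
  have "psubst u v (p * q) =
    psubst u v ((\<Sum>k\<in>Poly_Mapping.keys p. Poly_Mapping.single k (Poly_Mapping.lookup p k)) *
      (\<Sum>k\<in>Poly_Mapping.keys q. Poly_Mapping.single k (Poly_Mapping.lookup q k)))"
    by (simp flip: poly_mapping_sum_single)
  also have "\<dots> = psubst u v p * psubst u v q"
    by (simp add: sum_product psubst_sum mult_single psubst_single psubst_alt[of u v p]
        psubst_alt[of u v q] Const_simps mon_subst_add mult_ac)
  finally show ?thesis .
qed

lemma mon_subst_single_one [simp]: "mon_subst u (Poly_Mapping.single i 1) = u i"
  and mon_subst_zero [simp]: "mon_subst u 0 = 1"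
  by (simp_all add: mon_subst_def)

lemma psubst_Const: "psubst u v (Const c) = Const c"
  and psubst_yv: "psubst u v (yv i) = u i"
  and psubst_zv: "psubst u v (zv i) = v i"
  using mon_subst_single_one[of u i] mon_subst_single_one[of v i]
  by (simp_all add: Const_def yv_def zv_def psubst_single flip: zero_prod_def One_nat_def)

lemma gl_act_gen: "gl_act d g (gen j) = (\<Sum>i=1..d. gscale (g i j) (gen i))"
proof -
  have "(\<Sum>i=1..d. gscale (g i j) (gen i)) = (\<Sum>i=1..d. Poly_Mapping.single i (g i j), 0)" for d
    by (induction d) (auto simp: gscale_def gen_def zero_prod_def map_eq_zero_iff)
  then show ?thesis by (simp add: gl_act_def gen_def)
qed

lemma sum_const_single_left:
  fixes x :: "nat \<Rightarrow> 'k::field_char_0 yz_poly"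
  shows "(\<Sum>i\<in>Poly_Mapping.keys (\<Sum>j\<in>A. Poly_Mapping.single (h j) (c j)).
     Const (Poly_Mapping.lookup (\<Sum>j\<in>A. Poly_Mapping.single (h j) (c j)) i) * x i)
     = (\<Sum>j\<in>A. Const (c j) * x (h j))"
proof (induction A rule: infinite_finite_induct)
  case (insert a A)
  have "(\<Sum>i\<in>Poly_Mapping.keys (Poly_Mapping.single (h a) (c a)).
      Const (Poly_Mapping.lookup (Poly_Mapping.single (h a) (c a)) i) * x i) = Const (c a) * x (h a)"
    by (cases "c a = 0") (auto simp: Const_simps)
  then show ?case
    unfolding sum.insert[OF insert.hyps]
    by (subst sum_keys_add) (use insert.IH in \<open>auto simp: Const_simps algebra_simps\<close>)
qed auto

lemma gl_act_linear_part:
  "(\<Sum>i\<in>Poly_Mapping.keys (fst (gl_act d g f)). Const (Poly_Mapping.lookup (fst (gl_act d g f)) i) * x i)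
   = (\<Sum>j\<in>Poly_Mapping.keys (fst f). Const (Poly_Mapping.lookup (fst f) j) * (\<Sum>i=1..d. Const (g i j) * x i))"
proof -
  have "fst (gl_act d g f) = (\<Sum>k\<in>Poly_Mapping.keys (fst f) \<times> {1..d}.
      Poly_Mapping.single (snd k) (g (snd k) (fst k) * Poly_Mapping.lookup (fst f) (fst k)))"
    by (simp add: gl_act_def sum.cartesian_product split_def)
  then show ?thesis
    by (simp only: sum_const_single_left)
       (simp add: sum_distrib_left sum.cartesian_product split_def Const_simps mult_ac)
qed

lemma left_poly_gl_act:
  "left_poly (gl_act d g f) = psubst (\<lambda>j. \<Sum>i=1..d. Const (g i j) * yv i)
             (\<lambda>j. \<Sum>i=1..d. Const (g i j) * zv i) (left_poly f)"
  unfolding left_poly_def gl_act_linear_part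
  by (simp add: psubst_add psubst_sum psubst_mult psubst_Const psubst_yv) (simp add: gl_act_def)

lemma right_poly_gl_act:
  "right_poly (gl_act d g f) = psubst (\<lambda>j. \<Sum>i=1..d. Const (g i j) * yv i)
             (\<lambda>j. \<Sum>i=1..d. Const (g i j) * zv i) (right_poly f)"
  unfolding right_poly_def gl_act_linear_part
  by (simp add: psubst_add psubst_sum psubst_mult psubst_Const psubst_zv) (simp add: gl_act_def)

lemma gl_act_mult: "gl_act d g (gmul f h) = gmul (gl_act d g f) (gl_act d g h)"
  unfolding gmul_def left_poly_gl_act right_poly_gl_act psubst_mult[symmetric]
  by (simp add: gl_act_def pol_def)

lemma gl_act_add: "gl_act d g (f + h) = gl_act d g f + gl_act d g h"
  unfolding gl_act_def fst_add snd_add psubst_add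
  by (subst sum_keys_add) (auto simp: algebra_simps single_add sum.distrib)

lemma gl_act_scale: "gl_act d g (gscale c f) = gscale c (gl_act d g f)"
proof -
  have map_sum: "Poly_Mapping.map ((*) c) (\<Sum>i\<in>A. h i) = (\<Sum>i\<in>A. Poly_Mapping.map ((*) c) (h i))"
    for h :: "nat \<Rightarrow> nat \<Rightarrow>\<^sub>0 'a" and A
    by (rule poly_mapping_eqI) (simp add: lookup_map_scale lookup_sum sum_distrib_left)
  show ?thesis
    unfolding gl_act_def gscale_def fst_conv snd_conv
    by (subst sum_keys_scale)
       (auto simp: map_sum mult_ac map_scale_eq psubst_mult psubst_Const)
qed

lemma mdeg_pos_iff: "mdeg a \<ge> 1 \<longleftrightarrow> a \<noteq> 0"
  by (cases "a = 0") (auto simp: mdeg_def Suc_le_eq in_keys_iff intro!: sum_pos simp flip: keys_eq_empty)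

definition monomials_in :: "nat \<Rightarrow> bool \<Rightarrow> bool \<Rightarrow> 'k::field_char_0 yz_poly set" where
  "monomials_in d s t = {p. \<forall>(a, b)\<in>Poly_Mapping.keys p.
     Poly_Mapping.keys a \<subseteq> {1..d} \<and> Poly_Mapping.keys b \<subseteq> {1..d} \<and>
     (s \<longrightarrow> a \<noteq> 0) \<and> (t \<longrightarrow> b \<noteq> 0)}"

lemma G_carrier_iff:
  "f \<in> G_carrier d \<longleftrightarrow> Poly_Mapping.keys (fst f) \<subseteq> {1..d} \<and> snd f \<in> monomials_in d True True"
  unfolding G_carrier_def monomials_in_def mdeg_pos_iff by (auto simp: split_def)

lemma monomials_in_sum:
  assumes "\<And>i. i \<in> A \<Longrightarrow> f i \<in> monomials_in d s t"
  shows "(\<Sum>i\<in>A. f i) \<in> monomials_in d s t"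
  using assms keys_sum[of f A] unfolding monomials_in_def by fast

lemma nat_poly_mapping_add_eq_0: "(a + b = 0) \<longleftrightarrow> a = 0 \<and> b = (0 :: nat \<Rightarrow>\<^sub>0 nat)"
  by (auto simp: poly_mapping_eq_iff fun_eq_iff lookup_add)

lemma monomials_in_mult:
  assumes "p \<in> monomials_in d s t" "q \<in> monomials_in d s' t'"
  shows "p * q \<in> monomials_in d (s \<or> s') (t \<or> t')"
proof -
  have "Poly_Mapping.keys (fst m) \<subseteq> {1..d} \<and> Poly_Mapping.keys (snd m) \<subseteq> {1..d} \<and>
     (s \<or> s' \<longrightarrow> fst m \<noteq> 0) \<and> (t \<or> t' \<longrightarrow> snd m \<noteq> 0)"
    if m: "m \<in> Poly_Mapping.keys (p * q)" for m
  proof -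
    obtain k l where kl: "m = k + l" "k \<in> Poly_Mapping.keys p" "l \<in> Poly_Mapping.keys q"
      using keys_mult[of p q] m by auto
    have "Poly_Mapping.keys (fst m) \<subseteq> Poly_Mapping.keys (fst k) \<union> Poly_Mapping.keys (fst l)"
      "Poly_Mapping.keys (snd m) \<subseteq> Poly_Mapping.keys (snd k) \<union> Poly_Mapping.keys (snd l)"
      using kl(1) keys_add[of "fst k" "fst l"] keys_add[of "snd k" "snd l"]
      by (simp_all add: fst_add snd_add)
    moreover have "Poly_Mapping.keys (fst k) \<subseteq> {1..d}" "Poly_Mapping.keys (snd k) \<subseteq> {1..d}"
      "s \<longrightarrow> fst k \<noteq> 0" "t \<longrightarrow> snd k \<noteq> 0"
      using assms(1) kl(2) by (auto simp: monomials_in_def split_def)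
    moreover have "Poly_Mapping.keys (fst l) \<subseteq> {1..d}" "Poly_Mapping.keys (snd l) \<subseteq> {1..d}"
      "s' \<longrightarrow> fst l \<noteq> 0" "t' \<longrightarrow> snd l \<noteq> 0"
      using assms(2) kl(3) by (auto simp: monomials_in_def split_def)
    ultimately show ?thesis
      using kl(1) by (auto simp: fst_add snd_add nat_poly_mapping_add_eq_0)
  qed
  then show ?thesis by (auto simp: monomials_in_def split_def)
qed

lemma monomials_in_Const: "Const c \<in> monomials_in d False False"
  and monomials_in_1: "1 \<in> monomials_in d False False"
  and monomials_in_yv: "i \<in> {1..d} \<Longrightarrow> yv i \<in> monomials_in d True False"
  and monomials_in_zv: "i \<in> {1..d} \<Longrightarrow> zv i \<in> monomials_in d False True"
  by (auto simp: monomials_in_def Const_def yv_def zv_def zero_prod_def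
      simp flip: keys_eq_empty split: if_splits)

lemma monomials_in_mono:
  "p \<in> monomials_in d s t \<Longrightarrow> (s' \<longrightarrow> s) \<Longrightarrow> (t' \<longrightarrow> t) \<Longrightarrow> p \<in> monomials_in d s' t'"
  by (fastforce simp: monomials_in_def)

lemma monomials_in_power:
  assumes "p \<in> monomials_in d s t"
  shows "p ^ n \<in> monomials_in d (s \<and> n \<noteq> 0) (t \<and> n \<noteq> 0)"
proof (induction n)
  case 0
  show ?case using monomials_in_1 by simp
next
  case (Suc n)
  show ?case
    using monomials_in_mult[OF assms Suc.IH] by (auto elim!: monomials_in_mono)
qed

lemma monomials_in_prod:
  assumes "finite A" "\<And>i. i \<in> A \<Longrightarrow> f i \<in> monomials_in d s t"
  shows "(\<Prod>i\<in>A. f i) \<in> monomials_in d (s \<and> A \<noteq> {}) (t \<and> A \<noteq> {})"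
  using assms
proof (induction A rule: finite_induct)
  case empty
  show ?case using monomials_in_1 by simp
next
  case (insert a A)
  then have "f a * (\<Prod>i\<in>A. f i) \<in> monomials_in d (s \<or> s \<and> A \<noteq> {}) (t \<or> t \<and> A \<noteq> {})"
    by (intro monomials_in_mult) auto
  then show ?case using insert by (auto elim!: monomials_in_mono)
qed

lemma monomials_in_mon_subst:
  assumes "\<And>i. u i \<in> monomials_in d s t"
  shows "mon_subst u a \<in> monomials_in d (s \<and> a \<noteq> 0) (t \<and> a \<noteq> 0)"
proof -
  have "u i ^ Poly_Mapping.lookup a i \<in> monomials_in d s t" if "i \<in> Poly_Mapping.keys a" for i
    using monomials_in_power[OF assms, of i "Poly_Mapping.lookup a i"] that by (simp add: in_keys_iff)
  from monomials_in_prod[OF finite_keys this] show ?thesis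
    by (simp add: mon_subst_def)
qed

lemma gl_act_closed:
  assumes "f \<in> G_carrier d"
  shows "gl_act d g f \<in> G_carrier d"
proof -
  let ?u = "\<lambda>j. \<Sum>i=1..d. Const (g i j) * yv i"
  let ?v = "\<lambda>j. \<Sum>i=1..d. Const (g i j) * zv i"
  have u: "?u j \<in> monomials_in d True False" for j
    using monomials_in_mult[OF monomials_in_Const monomials_in_yv]
    by (intro monomials_in_sum) auto
  have v: "?v j \<in> monomials_in d False True" for j
    using monomials_in_mult[OF monomials_in_Const monomials_in_zv]
    by (intro monomials_in_sum) auto
  have "Const (Poly_Mapping.lookup (snd f) m) * mon_subst ?u (fst m) * mon_subst ?v (snd m)
      \<in> monomials_in d True True" if "m \<in> Poly_Mapping.keys (snd f)" for m
  proof -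
    have "fst m \<noteq> 0" "snd m \<noteq> 0"
      using assms that by (auto simp: G_carrier_iff monomials_in_def)
    then show ?thesis
      using monomials_in_mult[OF monomials_in_mult[OF monomials_in_Const
          monomials_in_mon_subst[of ?u, OF u, of "fst m"]]
          monomials_in_mon_subst[of ?v, OF v, of "snd m"]]
      by simp
  qed
  then have "snd (gl_act d g f) \<in> monomials_in d True True"
    by (auto simp: gl_act_def psubst_alt intro: monomials_in_sum)
  moreover have "Poly_Mapping.lookup (fst (gl_act d g f)) k = 0" if "k \<notin> {1..d}" for k
    using that by (auto simp: gl_act_def lookup_sum lookup_single when_def intro!: sum.neutral)
  ultimately show ?thesis
    unfolding G_carrier_iff by (metis in_keys_iff subsetI)
qed

lemma endomorphism_gl_act: "endomorphism_of (G d) (gl_act d g)"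
  by (simp add: endomorphism_of_def G_def gl_act_closed gl_act_add gl_act_scale gl_act_mult)

end

theory Submission
  imports Defs "HOL-Combinatorics.Transposition"
begin

text \<open>
  Every substitution of an element \<open>f\<close> of \<open>G\<^sub>d\<close> for \<open>x\<^sub>1\<close> replaces \<open>y\<^sub>1\<close> by the left and \<open>z\<^sub>1\<close> by the
  right polynomial of \<open>f\<close>, so the T-ideal of \<open>U\<^sub>\<alpha>\<close> contains all polarizations of its generator, both at
  generators and at products \<open>y\<^sub>m z\<^sub>n\<close>. In degree 4 these polarizations and their multiples form a linear
  system for the 14 multilinear monomials which has only the zero solution if
  \<open>\<alpha>\<^sub>1 \<alpha>\<^sub>2 (\<alpha>\<^sub>1 + \<alpha>\<^sub>2) (\<alpha>\<^sub>1 - \<alpha>\<^sub>2) \<noteq> 0\<close>: the component of degree 4 of the factor algebra is zero, which is (iv).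

  T-ideals and \<open>GL\<^sub>d\<close>-submodules of the factor algebra pull back to T-ideals and stable subspaces of \<open>G\<^sub>d\<close>
  containing the ideal. A T-ideal containing a nonzero form of degree 2 contains \<open>y\<^sub>1 z\<^sub>1\<close> or
  \<open>y\<^sub>1 z\<^sub>2 - y\<^sub>2 z\<^sub>1\<close>, and each of these yields all monomials of degree 3. For the stable subspaces, transpositions
  and transvections applied to the listed highest weight vectors yield all monomials. So both sides of each
  equivalence are the full homogeneous component.
\<close>

section \<open>Linear relations among the monomials of degrees 3 and 4\<close>

lemma Const_minus: "Const (- c) = - Const c"
  by (simp add: Const_def single_uminus)

lemma Const_diff: "Const (c - e) = Const c - Const e"
  by (simp add: Const_def single_diff)

lemma Const_numeral: "Const (numeral n) = numeral n"
  by (induction n) (simp_all only: numeral.simps Const_simps)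

text \<open>Applied to \<open>{p. pol p \<in> M}\<close> for a subspace \<open>M\<close> of
  \<open>G d\<close>. Membership then reduces to exhibiting a linear combination in the commutative
  polynomial ring, which \<open>algebra_simps\<close> verifies and whose terms are handled by the
  rules \<open>closed\<close>.\<close>

locale yz_subspace =
  fixes N :: "'k::field_char_0 yz_poly set"
  assumes zero [simp]: "0 \<in> N"
    and add: "p \<in> N \<Longrightarrow> q \<in> N \<Longrightarrow> p + q \<in> N"
    and smult: "p \<in> N \<Longrightarrow> Const c * p \<in> N"
begin

lemma uminus: "p \<in> N \<Longrightarrow> - p \<in> N"
  using smult[of p "- 1"] by (simp add: Const_minus Const_simps)

lemma diff: "p \<in> N \<Longrightarrow> q \<in> N \<Longrightarrow> p - q \<in> N"
  using add[of p "- q"] uminus by simp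

lemma sum: "(\<And>i. i \<in> A \<Longrightarrow> f i \<in> N) \<Longrightarrow> (\<Sum>i\<in>A. f i) \<in> N"
  by (induction A rule: infinite_finite_induct) (auto intro: add)

lemma numeral_mult: "p \<in> N \<Longrightarrow> numeral n * p \<in> N"
  using smult[of p "numeral n"] by (simp add: Const_numeral)

lemmas closed = add diff uminus smult numeral_mult

lemma cancel: "Const c * p \<in> N \<Longrightarrow> c \<noteq> 0 \<Longrightarrow> p \<in> N"
  using smult[of "Const c * p" "inverse c"]
  by (simp add: Const_simps(2) flip: Const_simps(4) mult.assoc)

lemma cancel_numeral: "numeral n * p \<in> N \<Longrightarrow> p \<in> N"
  using cancel[of "numeral n" p] by (simp add: Const_numeral)

text \<open>\<open>P i j k\<close> is the polarized identity at x_i, x_j, x_k. Polarizing at x_i,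
  x_j and the product y_m z_n gives \<open>y m * z n * Q i j\<close>, because the left and the right
  polynomial of such a product coincide. The unknowns are eliminated in the order: sum of all b_ij,
  partial sums S, then the a_l and c_i, last the single b_ij. Indices may coincide, so repeated
  variables are covered too.\<close>

lemma quartic_monomials:
  fixes y z :: "nat \<Rightarrow> 'k yz_poly" and D :: "nat set"
    and \<alpha>\<^sub>1 \<alpha>\<^sub>2 :: 'k
  defines "P i j k \<equiv> Const \<alpha>\<^sub>1 * (y i * y j * z k + y i * y k * z j + y j * y k * z i) +
      Const \<alpha>\<^sub>2 * (y i * z j * z k + y j * z i * z k + y k * z i * z j)"
    and "Q i j \<equiv> Const \<alpha>\<^sub>1 * y i * y j + (Const \<alpha>\<^sub>1 + Const \<alpha>\<^sub>2) * (y i * z j + y j * z i) +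
      Const \<alpha>\<^sub>2 * z i * z j"
  assumes \<alpha>: "\<alpha>\<^sub>1 \<noteq> 0" "\<alpha>\<^sub>2 \<noteq> 0" "\<alpha>\<^sub>1 + \<alpha>\<^sub>2 \<noteq> 0" "\<alpha>\<^sub>1 \<noteq> \<alpha>\<^sub>2"
    and A: "\<And>m i j k. {m, i, j, k} \<subseteq> D \<Longrightarrow> y m * P i j k \<in> N"
    and B: "\<And>m i j k. {m, i, j, k} \<subseteq> D \<Longrightarrow> P i j k * z m \<in> N"
    and C: "\<And>m n i j. {m, n, i, j} \<subseteq> D \<Longrightarrow> y m * z n * Q i j \<in> N"
    and D: "{i, j, k, l} \<subseteq> D"
  shows "y i * y j * y k * z l \<in> N" "y i * y j * z k * z l \<in> N" "y i * z j * z k * z l \<in> N"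
proof -
  (* With a_l, b_ij, c_i the multilinear monomials of bidegree (3,1), (2,2), (1,3), indexed by their
     z-variable, y-variables and y-variable: S is the sum of the b_mn over n, and beta of all b_ij. *)
  define b where "b i j k l = y i * y j * z k * z l" for i j k l
  define S where "S m i j k = b m i j k + b m j i k + b m k i j" for m i j k
  define \<beta> where "\<beta> m i j k = S m i j k + b i j m k + b i k m j + b j k m i" for m i j k
  have sumA: "y i * P j k l + y j * P i k l + y k * P i j l + y l * P i j k \<in> N" 
    if "{i, j, k, l} \<subseteq> D" for i j k l
    using that by (intro add A) auto
  have sumB: "P j k l * z i + P i k l * z j + P i j l * z k + P i j k * z l \<in> N"
    if "{i, j, k, l} \<subseteq> D" for i j k l
    using that by (intro add B) auto
  have sumC: "y m * z i * Q j k + y m * z j * Q i k + y m * z k * Q i j \<in> N"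
    if "{m, i, j, k} \<subseteq> D" for m i j k
    using that by (intro add C) auto
  have \<beta>: "\<beta> m i j k \<in> N" if *: "{m, i, j, k} \<subseteq> D" for m i j k
  proof -
    \<comment> \<open>The twelve Q-relations add up to 3 alpha_1 sum(a) + 4 (alpha_1 + alpha_2)
      \<beta> + 3 alpha_2 sum(c). The P-relations times y add up to 3 alpha_1 sum(a) + 2 alpha_2
      \<beta>, those times z to 2 alpha_1 \<beta> + 3 alpha_2 sum(c), so only \<beta>
      survives.\<close>
    have "Const (\<alpha>\<^sub>1 + \<alpha>\<^sub>2) * (2 * \<beta> m i j k) =
      (y m * z i * Q j k + y m * z j * Q i k + y m * z k * Q i j) +
      (y i * z m * Q j k + y i * z j * Q m k + y i * z k * Q m j) +
      (y j * z m * Q i k + y j * z i * Q m k + y j * z k * Q m i) +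
      (y k * z m * Q i j + y k * z i * Q m j + y k * z j * Q m i) -
      (y m * P i j k + y i * P m j k + y j * P m i k + y k * P m i j) -
      (P i j k * z m + P m j k * z i + P m i k * z j + P m i j * z k)"
      unfolding \<beta>_def S_def b_def P_def Q_def Const_simps by (simp add: algebra_simps)
    also have "\<dots> \<in> N"
      using * by (intro closed sumA sumB sumC) auto
    finally show ?thesis
      using cancel[OF _ \<alpha>(3)] cancel_numeral by blast
  qed
  have S: "S m i j k \<in> N" if *: "{m, i, j, k} \<subseteq> D" for m i j k
  proof -
    \<comment> \<open>The three Q-relations minus y_m P_ijk leave (2 alpha_1 + alpha_2) S_m + 3
      alpha_2 c_m; the terms with P times z contribute alpha_1 \<beta> - 3 alpha_1 S_m - 3 alpha_2
      c_m. Hence c_m cancels, and the remaining factor is where alpha_1 \<noteq> alpha_2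
      enters.\<close>
    have "Const (\<alpha>\<^sub>2 - \<alpha>\<^sub>1) * S m i j k =
      (y m * z i * Q j k + y m * z j * Q i k + y m * z k * Q i j) - y m * P i j k +
      3 * (P i j k * z m) - (P i j k * z m + P m j k * z i + P m i k * z j + P m i j * z k) -
      Const \<alpha>\<^sub>1 * \<beta> m i j k"
      unfolding \<beta>_def S_def b_def P_def Q_def Const_simps Const_diff by (simp add: algebra_simps)
    also have "\<dots> \<in> N"
      using * by (intro closed A B sumB sumC \<beta>) auto
    finally show ?thesis
      using cancel \<alpha>(4) by force
  qed
  \<comment> \<open>The alpha_2 part of y_m P_ijk is S_m, which is now known to vanish modulo
    \<open>N\<close>; what remains is the sum of the three a_l with l \<noteq> m. In
    \<open>c3\<close> the alpha_1 part of P_ijk z_m is \<beta> - S_m, and the sum of the three c_i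
    is left.\<close>
  have a3: "y m * (y j * y k * z i + y i * y k * z j + y i * y j * z k) \<in> N"
    if *: "{m, i, j, k} \<subseteq> D" for m i j k
  proof -
    have "Const \<alpha>\<^sub>1 * (y m * (y j * y k * z i + y i * y k * z j + y i * y j * z k)) =
      y m * P i j k - Const \<alpha>\<^sub>2 * S m i j k"
      unfolding S_def b_def P_def by (simp add: algebra_simps)
    also have "\<dots> \<in> N"
      using * by (intro closed A S) auto
    finally show ?thesis
      using cancel \<alpha>(1) by blast
  qed
  have c3: "z m * (z j * z k * y i + z i * z k * y j + z i * z j * y k) \<in> N"
    if *: "{m, i, j, k} \<subseteq> D" for m i j k
  proof -
    have "Const \<alpha>\<^sub>2 * (z m * (z j * z k * y i + z i * z k * y j + z i * z j * y k)) =
      P i j k * z m - Const \<alpha>\<^sub>1 * (\<beta> m i j k - S m i j k)"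
      unfolding \<beta>_def S_def b_def P_def by (simp add: algebra_simps)
    also have "\<dots> \<in> N"
      using * by (intro closed B S \<beta>) auto
    finally show ?thesis
      using cancel \<alpha>(2) by blast
  qed
  have a: "y i * y j * y k * z l \<in> N" if *: "{i, j, k, l} \<subseteq> D" for i j k l
  proof -
    \<comment> \<open>Each sum in \<open>a3\<close> omits one of the four unknowns: adding the three
      that contain a_l and subtracting twice the one that omits it isolates 3 a_l.\<close>
    have "3 * (y i * y j * y k * z l) =
      y i * (y k * y l * z j + y j * y l * z k + y j * y k * z l) +
      y j * (y k * y l * z i + y i * y l * z k + y i * y k * z l) +
      y k * (y j * y l * z i + y i * y l * z j + y i * y j * z l) -
      2 * (y l * (y j * y k * z i + y i * y k * z j + y i * y j * z k))"
      by (simp add: algebra_simps)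
    also have "\<dots> \<in> N"
      using * by (intro closed a3) auto
    finally show ?thesis
      using cancel_numeral by blast
  qed
  have c: "y i * z j * z k * z l \<in> N" if *: "{i, j, k, l} \<subseteq> D" for i j k l
  proof -
    have "3 * (y i * z j * z k * z l) =
      z l * (z j * z k * y i + z i * z k * y j + z i * z j * y k) +
      z j * (z k * z l * y i + z i * z l * y k + z i * z k * y l) +
      z k * (z j * z l * y i + z i * z l * y j + z i * z j * y l) -
      2 * (z i * (z k * z l * y j + z j * z l * y k + z j * z k * y l))"
      by (simp add: algebra_simps)
    also have "\<dots> \<in> N"
      using * by (intro closed c3) auto
    finally show ?thesis
      using cancel_numeral by blast
  qed
  show "y i * y j * y k * z l \<in> N" "y i * z j * z k * z l \<in> N"
    using a c D by auto
  \<comment> \<open>Modulo the a and c, y_i z_j Q_kl is (alpha_1 + alpha_2) (b_ik + b_il), that is,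
    S_i without its term b_ij.\<close>
  have "Const (\<alpha>\<^sub>1 + \<alpha>\<^sub>2) * (y i * y j * z k * z l) =
    Const \<alpha>\<^sub>1 * (y i * y k * y l * z j) + Const (\<alpha>\<^sub>1 + \<alpha>\<^sub>2) * S i j k l +
    Const \<alpha>\<^sub>2 * (y i * z j * z k * z l) - y i * z j * Q k l"
    unfolding S_def b_def Q_def Const_simps by (simp add: algebra_simps)
  also have "\<dots> \<in> N"
    using D by (intro closed a c C S) auto
  finally show "y i * y j * z k * z l \<in> N"
    using cancel \<alpha>(3) by blast
qed

text \<open>Three unknowns are determined by their pairwise sums, since 2 is invertible. The
  families \<open>y\<close> and \<open>z\<close> are arbitrary, so that exchanging them gives the
  other bidegree.\<close>

lemma cubic_monomials_of_sym:
  fixes y z :: "nat \<Rightarrow> 'k yz_poly"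
  assumes "\<And>i j k. {i, j, k} \<subseteq> D \<Longrightarrow> y k * (y i * z j + y j * z i) \<in> N"
    and "{i, j, k} \<subseteq> D"
  shows "y i * y j * z k \<in> N"
proof -
  have "2 * (y i * y j * z k) = y i * (y j * z k + y k * z j) + y j * (y i * z k + y k * z i) -
    y k * (y i * z j + y j * z i)"
    by (simp add: algebra_simps)
  also have "\<dots> \<in> N"
    using assms(2) by (intro closed assms(1)) auto
  finally show ?thesis
    using cancel_numeral by blast
qed

text \<open>Modulo \<open>N\<close>, condition A lets the z-index move freely among the monomials of
  bidegree (2,1), and B identifies them with those of bidegree (1,2). All six multilinear monomials
  become equal, so the polarized identity reduces to 3 (alpha_1 + alpha_2) times one of
  them.\<close>

lemma cubic_monomials_of_skew:
  fixes y z :: "nat \<Rightarrow> 'k yz_poly"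
  assumes \<alpha>: "\<alpha>\<^sub>1 + \<alpha>\<^sub>2 \<noteq> 0"
    and P: "\<And>i j k. {i, j, k} \<subseteq> D \<Longrightarrow>
      Const \<alpha>\<^sub>1 * (y i * y j * z k + y i * y k * z j + y j * y k * z i) +
      Const \<alpha>\<^sub>2 * (y i * z j * z k + y j * z i * z k + y k * z i * z j) \<in> N"
    and A: "\<And>i j k. {i, j, k} \<subseteq> D \<Longrightarrow> y k * (y i * z j - y j * z i) \<in> N"
    and B: "\<And>i j k. {i, j, k} \<subseteq> D \<Longrightarrow> y j * z k * (y i - z i) \<in> N"
    and D: "{i, j, k} \<subseteq> D"
  shows "y i * y j * z k \<in> N" "y i * z j * z k \<in> N"
proof -
  have a: "y i * y j * z k \<in> N" if *: "{i, j, k} \<subseteq> D" for i j k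
  proof -
    have "Const (\<alpha>\<^sub>1 + \<alpha>\<^sub>2) * (3 * (y i * y j * z k)) =
      Const \<alpha>\<^sub>1 * (y i * y j * z k + y i * y k * z j + y j * y k * z i) +
      Const \<alpha>\<^sub>2 * (y i * z j * z k + y j * z i * z k + y k * z i * z j) +
      Const (\<alpha>\<^sub>1 + \<alpha>\<^sub>2) * (y i * (y j * z k - y k * z j)) +
      Const \<alpha>\<^sub>1 * (y j * (y i * z k - y k * z i)) +
      Const \<alpha>\<^sub>2 * (y i * z k * (y j - z j) + y j * z k * (y i - z i) + y k * z j * (y i - z i))"
      unfolding Const_simps by (simp add: algebra_simps)
    also have "\<dots> \<in> N"
      using * by (intro closed A B P) auto
    finally show ?thesis
      using cancel \<alpha> cancel_numeral by blast
  qed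
  show "y i * y j * z k \<in> N"
    using a D by auto
  have "y i * z j * z k = y j * y i * z k - y i * z k * (y j - z j)"
    by (simp add: algebra_simps)
  also have "\<dots> \<in> N"
    using D by (intro closed a B) auto
  finally show "y i * z j * z k \<in> N" .
qed

text \<open>The hypotheses are images of y_1^2 z_1 and of y_1 (y_1 z_2 - y_2 z_1) under permutations
  and transvections. The first kind yields symmetric sums of monomials, the second kind differences;
  together they separate the monomials.\<close>

lemma cubic_monomials_of_highest_weight:
  fixes y z :: "nat \<Rightarrow> 'k yz_poly"
  assumes cube: "\<And>i. i \<in> D \<Longrightarrow> y i * y i * z i \<in> N"
    and sum: "\<And>i j. {i, j} \<subseteq> D \<Longrightarrow> i \<noteq> j \<Longrightarrow> (y i + y j) * (y i + y j) * (z i + z j) \<in> N"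
    and dif: "\<And>i j. {i, j} \<subseteq> D \<Longrightarrow> i \<noteq> j \<Longrightarrow> (y i - y j) * (y i - y j) * (z i - z j) \<in> N"
    and skew: "\<And>i j. {i, j} \<subseteq> D \<Longrightarrow> i \<noteq> j \<Longrightarrow> y i * (y i * z j - y j * z i) \<in> N"
    and skew_sum: "\<And>i j k. {i, j, k} \<subseteq> D \<Longrightarrow> distinct [i, j, k] \<Longrightarrow>
      (y i + y j) * ((y i + y j) * z k - y k * (z i + z j)) \<in> N"
    and sym_sum: "\<And>i j k. {i, j, k} \<subseteq> D \<Longrightarrow> distinct [i, j, k] \<Longrightarrow>
      (y i + y j + y k) * (y i + y j + y k) * (z i + z j + z k) \<in> N"
    and D: "{i, j, k} \<subseteq> D"
  shows "y i * y j * z k \<in> N"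
proof -
  have iij: "y i * y i * z j \<in> N" "y i * y j * z i \<in> N" if *: "{i, j} \<subseteq> D" "i \<noteq> j" for i j
  proof -
    \<comment> \<open>The difference of the two cubes keeps the part odd in the index j, namely 2
      y_i^2 z_j + 4 y_i y_j z_i + 2 y_j^2 z_j. The skew relation converts the middle monomial into
      the first.\<close>
    have "6 * (y i * y i * z j) = (y i + y j) * (y i + y j) * (z i + z j) -
      (y i - y j) * (y i - y j) * (z i - z j) - 2 * (y j * y j * z j) +
      4 * (y i * (y i * z j - y j * z i))"
      by (simp add: algebra_simps)
    also have "\<dots> \<in> N"
      using * by (intro closed cube sum dif skew) auto
    finally show ii: "y i * y i * z j \<in> N"
      using cancel_numeral by blast
    have "y i * y j * z i = y i * y i * z j - y i * (y i * z j - y j * z i)"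
      by (simp add: algebra_simps)
    also have "\<dots> \<in> N"
      using * by (intro closed ii skew) auto
    finally show "y i * y j * z i \<in> N" .
  qed
  have ijk: "y i * y j * z k \<in> N" if *: "{i, j, k} \<subseteq> D" "distinct [i, j, k]"
  proof -
    \<comment> \<open>Inclusion-exclusion on the cubes leaves twice the sum of the three multilinear
      monomials; the mixed part of \<open>skew_sum\<close> is 2 y_i y_j z_k - y_i y_k z_j - y_j y_k
      z_i, and twice it cancels the two unwanted ones.\<close>
    have "6 * (y i * y j * z k) = (y i + y j + y k) * (y i + y j + y k) * (z i + z j + z k) -
      (y i + y j) * (y i + y j) * (z i + z j) - (y i + y k) * (y i + y k) * (z i + z k) -
      (y j + y k) * (y j + y k) * (z j + z k) + y i * y i * z i + y j * y j * z j + y k * y k * z k +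
      2 * ((y i + y j) * ((y i + y j) * z k - y k * (z i + z j))) -
      2 * (y i * (y i * z k - y k * z i)) - 2 * (y j * (y j * z k - y k * z j))"
      by (simp add: algebra_simps)
    also have "\<dots> \<in> N"
      using * by (intro closed cube sum sym_sum skew skew_sum) auto
    finally show ?thesis
      using cancel_numeral by blast
  qed
  show ?thesis
    using D cube[of i] iij[of i j] iij[of i k] iij[of j i] ijk
    by (cases "i = j"; cases "i = k"; cases "j = k") (auto simp: mult_ac)
qed

end

section \<open>Degrees, factorization of monomials into variables, homogeneity\<close>

lemma mdeg_superset:
  assumes "finite A" "Poly_Mapping.keys a \<subseteq> A"
  shows "mdeg a = (\<Sum>i\<in>A. Poly_Mapping.lookup a i)"
  unfolding mdeg_def using assms by (intro sum.mono_neutral_left) (auto simp: in_keys_iff)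

lemma mdeg_add: "mdeg (a + b) = mdeg a + mdeg b"
proof -
  let ?K = "Poly_Mapping.keys a \<union> Poly_Mapping.keys b"
  have "mdeg c = (\<Sum>i\<in>?K. Poly_Mapping.lookup c i)" if "Poly_Mapping.keys c \<subseteq> ?K" for c
    using that by (intro mdeg_superset) auto
  then show ?thesis
    using keys_add[of a b] by (simp add: lookup_add sum.distrib)
qed

lemma mdeg_zero [simp]: "mdeg 0 = 0"
  by (simp add: mdeg_def)

lemma mdeg_single [simp]: "mdeg (Poly_Mapping.single i n) = n"
  by (simp add: mdeg_def)

lemma mdeg_Suc_decompose:
  assumes "mdeg a = Suc n"
  obtains i a' where "a = Poly_Mapping.single i 1 + a'" "mdeg a' = n"
    "i \<in> Poly_Mapping.keys a" "Poly_Mapping.keys a' \<subseteq> Poly_Mapping.keys a"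
proof -
  from assms have "a \<noteq> 0" by auto
  then obtain i where i: "i \<in> Poly_Mapping.keys a"
    by (metis all_not_in_conv keys_eq_empty)
  define a' where "a' = a - Poly_Mapping.single i 1"
  have a: "a = Poly_Mapping.single i 1 + a'"
    unfolding a'_def using i
    by (intro poly_mapping_eqI) (auto simp: lookup_add lookup_minus lookup_single when_def in_keys_iff)
  have "Poly_Mapping.keys a' \<subseteq> Poly_Mapping.keys a"
    unfolding a'_def by (auto simp: lookup_minus in_keys_iff)
  with that[OF a] i a assms show thesis
    by (metis Suc_inject mdeg_add mdeg_single plus_1_eq_Suc)
qed

text \<open>Replaces exponent vectors by lists of indices, so that the monomials of a given degree
  can be enumerated by the lengths of two lists.\<close>

lemma y_monomial_prod_list:
  assumes "mdeg a = n" "Poly_Mapping.keys a \<subseteq> D"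
  shows "\<exists>js. length js = n \<and> set js \<subseteq> D \<and>
    Poly_Mapping.single (a, 0) (1::'k::field_char_0) = prod_list (map yv js)"
  using assms
proof (induction n arbitrary: a)
  case 0
  then have "a = 0"
    using mdeg_pos_iff[of a] by auto
  then show ?case by (simp flip: zero_prod_def)
next
  case (Suc n)
  from Suc.prems(1) obtain i a' where a': "a = Poly_Mapping.single i 1 + a'" "mdeg a' = n"
    "i \<in> Poly_Mapping.keys a" "Poly_Mapping.keys a' \<subseteq> Poly_Mapping.keys a"
    by (rule mdeg_Suc_decompose)
  then obtain js where js: "length js = n" "set js \<subseteq> D"
    "Poly_Mapping.single (a', 0) (1::'k) = prod_list (map yv js)"
    using Suc.IH[of a'] Suc.prems(2) by auto
  have "Poly_Mapping.single (a, 0) (1::'k) = yv i * Poly_Mapping.single (a', 0) 1"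
    by (simp add: yv_def mult_single a'(1))
  then show ?case
    using js a'(3) Suc.prems(2) by (intro exI[of _ "i # js"]) auto
qed

lemma z_monomial_prod_list:
  assumes "mdeg b = n" "Poly_Mapping.keys b \<subseteq> D"
  shows "\<exists>js. length js = n \<and> set js \<subseteq> D \<and>
    Poly_Mapping.single (0, b) (1::'k::field_char_0) = prod_list (map zv js)"
  using assms
proof (induction n arbitrary: b)
  case 0
  then have "b = 0"
    using mdeg_pos_iff[of b] by auto
  then show ?case by (simp flip: zero_prod_def)
next
  case (Suc n)
  from Suc.prems(1) obtain i b' where b': "b = Poly_Mapping.single i 1 + b'" "mdeg b' = n"
    "i \<in> Poly_Mapping.keys b" "Poly_Mapping.keys b' \<subseteq> Poly_Mapping.keys b"
    by (rule mdeg_Suc_decompose)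
  then obtain js where js: "length js = n" "set js \<subseteq> D"
    "Poly_Mapping.single (0, b') (1::'k) = prod_list (map zv js)"
    using Suc.IH[of b'] Suc.prems(2) by auto
  have "Poly_Mapping.single (0, b) (1::'k) = zv i * Poly_Mapping.single (0, b') 1"
    by (simp add: zv_def mult_single b'(1))
  then show ?case
    using js b'(3) Suc.prems(2) by (intro exI[of _ "i # js"]) auto
qed

definition homogeneous :: "nat \<Rightarrow> 'k::field_char_0 yz_poly set" where
  "homogeneous n = {p. \<forall>m\<in>Poly_Mapping.keys p. mdeg (fst m) + mdeg (snd m) = n}"

lemma homogeneous_sum:
  "(\<And>i. i \<in> A \<Longrightarrow> f i \<in> homogeneous n) \<Longrightarrow> (\<Sum>i\<in>A. f i) \<in> homogeneous n"
  using keys_sum[of f A] unfolding homogeneous_def by blast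

lemma homogeneous_mult:
  assumes "p \<in> homogeneous m" "q \<in> homogeneous n"
  shows "p * q \<in> homogeneous (m + n)"
proof -
  have "mdeg (fst k) + mdeg (snd k) = m + n" if *: "k \<in> Poly_Mapping.keys (p * q)" for k
  proof -
    obtain k1 k2 where k: "k = k1 + k2" "k1 \<in> Poly_Mapping.keys p" "k2 \<in> Poly_Mapping.keys q"
      using keys_mult[of p q] * by blast
    with assms have "mdeg (fst k1) + mdeg (snd k1) = m" "mdeg (fst k2) + mdeg (snd k2) = n"
      unfolding homogeneous_def by auto
    then show ?thesis
      by (simp add: k(1) mdeg_add)
  qed
  then show ?thesis
    unfolding homogeneous_def by blast
qed

lemma homogeneous_Const: "Const c \<in> homogeneous 0"
  and homogeneous_yv: "yv i \<in> homogeneous 1"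
  and homogeneous_zv: "zv i \<in> homogeneous 1"
  by (auto simp: homogeneous_def Const_def yv_def zv_def split: if_splits)

lemma homogeneous_power: "p \<in> homogeneous n \<Longrightarrow> p ^ k \<in> homogeneous (k * n)"
proof (induction k)
  case 0
  then show ?case using homogeneous_Const[of 1] by (simp add: Const_simps)
next
  case (Suc k)
  then show ?case using homogeneous_mult[of p n "p ^ k" "k * n"] by simp
qed

lemma homogeneous_prod:
  "(\<And>i. i \<in> A \<Longrightarrow> f i \<in> homogeneous (n i)) \<Longrightarrow> (\<Prod>i\<in>A. f i) \<in> homogeneous (\<Sum>i\<in>A. n i)"
proof (induction A rule: infinite_finite_induct)
  case (insert i A)
  then show ?case by (auto intro!: homogeneous_mult)
qed (use homogeneous_Const[of 1] in \<open>simp_all add: Const_simps\<close>)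

lemma homogeneous_mon_subst:
  "(\<And>i. u i \<in> homogeneous 1) \<Longrightarrow> mon_subst u a \<in> homogeneous (mdeg a)"
  unfolding mon_subst_def mdeg_def
  using homogeneous_power[of _ 1] by (intro homogeneous_prod) auto

lemma homogeneous_psubst:
  assumes "\<And>i. u i \<in> homogeneous 1" "\<And>i. v i \<in> homogeneous 1" "p \<in> homogeneous n"
  shows "psubst u v p \<in> homogeneous n"
  unfolding psubst_alt
proof (rule homogeneous_sum)
  fix m assume "m \<in> Poly_Mapping.keys p"
  with assms(3) have "0 + mdeg (fst m) + mdeg (snd m) = n"
    by (simp add: homogeneous_def)
  then show "Const (Poly_Mapping.lookup p m) * mon_subst u (fst m) * mon_subst v (snd m) \<in> homogeneous n"
    using assms homogeneous_Const homogeneous_mon_subst homogeneous_mult by metis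
qed

lemma G_comp_iff:
  "f \<in> G_comp d n \<longleftrightarrow> f \<in> G_carrier d \<and> (fst f \<noteq> 0 \<longrightarrow> n = 1) \<and> snd f \<in> homogeneous n"
  by (cases f) (auto simp: G_comp_def homogeneous_def split_def)

section \<open>Subspaces and homogeneous components of \<open>G d\<close>\<close>

lemma subspace_G_iff:
  "subspace_of (G d) M \<longleftrightarrow> M \<subseteq> G_carrier d \<and> 0 \<in> M \<and>
     (\<forall>x\<in>M. \<forall>y\<in>M. x + y \<in> M) \<and> (\<forall>c. \<forall>x\<in>M. gscale c x \<in> M)"
  by (simp add: subspace_of_def G_def)

lemma subspace_G_D:
  assumes "subspace_of (G d) M"
  shows "0 \<in> M" "\<And>f g. f \<in> M \<Longrightarrow> g \<in> M \<Longrightarrow> f + g \<in> M" "\<And>c f. f \<in> M \<Longrightarrow> gscale c f \<in> M"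
    "\<And>f. f \<in> M \<Longrightarrow> f \<in> G_carrier d"
  using assms[unfolded subspace_G_iff] by (simp_all add: subset_iff del: split_paired_All)

lemma pol_0 [simp]: "pol 0 = 0"
  by (simp add: pol_def zero_prod_def)

lemma gscale_add_left: "gscale (c + e) f = gscale c f + gscale e f"
  by (simp add: gscale_def prod_eq_iff poly_mapping_eq_iff fun_eq_iff lookup_map_scale lookup_add algebra_simps)

lemma gscale_add_right: "gscale c (f + g) = gscale c f + gscale c g"
  by (simp add: gscale_def prod_eq_iff poly_mapping_eq_iff fun_eq_iff lookup_map_scale lookup_add algebra_simps)

lemma gscale_gscale: "gscale c (gscale e f) = gscale (c * e) f"
  by (simp add: gscale_def prod_eq_iff poly_mapping_eq_iff fun_eq_iff lookup_map_scale algebra_simps)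

lemma gscale_0 [simp]: "gscale 0 f = 0" "gscale c 0 = 0"
  by (simp_all add: gscale_def prod_eq_iff poly_mapping_eq_iff fun_eq_iff lookup_map_scale)

lemma gscale_1 [simp]: "gscale 1 f = f"
  by (simp add: gscale_def prod_eq_iff poly_mapping_eq_iff fun_eq_iff lookup_map_scale)

lemma gscale_sum: "gscale c (\<Sum>i\<in>A. f i) = (\<Sum>i\<in>A. gscale c (f i))"
  by (induction A rule: infinite_finite_induct) (simp_all add: gscale_add_right)

lemma gscale_minus_one: "gscale (- 1) f = - f"
  by (simp add: gscale_def prod_eq_iff poly_mapping_eq_iff fun_eq_iff lookup_map_scale)

lemma snd_gscale: "snd (gscale c f) = Const c * snd f"
  by (simp add: gscale_def map_scale_eq)

lemma lookup_fst_gscale: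
  "Poly_Mapping.lookup (fst (gscale c f)) k = c * Poly_Mapping.lookup (fst f) k"
  by (simp add: gscale_def lookup_map_scale)

lemma subspace_G_uminus: "subspace_of (G d) M \<Longrightarrow> f \<in> M \<Longrightarrow> - f \<in> M"
  by (metis gscale_minus_one subspace_G_iff)

lemma subspace_G_sum:
  "subspace_of (G d) M \<Longrightarrow> (\<And>i. i \<in> A \<Longrightarrow> f i \<in> M) \<Longrightarrow> (\<Sum>i\<in>A. f i) \<in> M"
  by (induction A rule: infinite_finite_induct) (auto simp: subspace_G_iff)

lemma yz_subspace_pol:
  assumes "subspace_of (G d) M"
  shows "yz_subspace {p. pol p \<in> M}"
  by unfold_locales (use assms in \<open>auto simp: subspace_G_iff pol_add simp flip: gscale_pol\<close>)

lemma monomials_in_zero: "0 \<in> monomials_in d s t"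
  by (simp add: monomials_in_def)

lemma monomials_in_add:
  "p \<in> monomials_in d s t \<Longrightarrow> q \<in> monomials_in d s t \<Longrightarrow> p + q \<in> monomials_in d s t"
  unfolding monomials_in_def mem_Collect_eq by (meson UnE keys_add subsetD)

lemma homogeneous_add: "p \<in> homogeneous n \<Longrightarrow> q \<in> homogeneous n \<Longrightarrow> p + q \<in> homogeneous n"
  unfolding homogeneous_def mem_Collect_eq by (meson UnE keys_add subsetD)

lemma subspace_G_carrier: "subspace_of (G d) (G_carrier d :: 'k::field_char_0 galg set)"
proof -
  have "gscale c f \<in> G_carrier d" if "f \<in> G_carrier d" for c and f :: "'k galg"
    using that monomials_in_mult[OF monomials_in_Const, of "snd f" d True True c]
    by (simp add: G_carrier_iff snd_gscale subset_iff in_keys_iff lookup_fst_gscale)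
  moreover have "f + g \<in> G_carrier d" if "f \<in> G_carrier d" "g \<in> G_carrier d" for f g :: "'k galg"
    using that keys_add[of "fst f" "fst g"] by (auto simp: G_carrier_iff intro: monomials_in_add)
  ultimately show ?thesis
    unfolding subspace_G_iff by (simp add: G_carrier_iff[of 0] monomials_in_zero)
qed

lemma subspace_G_comp: "subspace_of (G d) (G_comp d n :: 'k::field_char_0 galg set)"
proof -
  note C = subspace_G_D[OF subspace_G_carrier[of d, where 'k = 'k]]
  have "f + g \<in> G_comp d n" if "f \<in> G_comp d n" "g \<in> G_comp d n" for f g :: "'k galg"
    using that C(2)[of f g] homogeneous_add[of "snd f" n "snd g"]
    by (cases "n = 1") (simp_all add: G_comp_iff)
  moreover have "gscale c f \<in> G_comp d n" if "f \<in> G_comp d n" for c and f :: "'k galg"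
    using that C(3)[of f c] homogeneous_mult[OF homogeneous_Const, of "snd f" n c]
    by (auto simp: G_comp_iff snd_gscale poly_mapping_eq_iff fun_eq_iff lookup_fst_gscale)
  moreover have "0 \<in> G_comp d n"
    by (simp add: G_comp_iff G_carrier_iff monomials_in_zero homogeneous_def)
  moreover have "f \<in> G_carrier d" if "f \<in> G_comp d n" for f :: "'k galg"
    using that by (simp add: G_comp_iff)
  ultimately show ?thesis
    unfolding subspace_G_iff by (intro conjI ballI allI subsetI)
qed

text \<open>Monomials span every component except that of degree 1, where the elements are
  combinations of the generators and have no polynomial part; hence
  \<open>n \<noteq> 1\<close>.\<close>

lemma G_comp_subset:
  fixes M :: "'k::field_char_0 galg set"
  assumes M: "subspace_of (G d) M" and "n \<noteq> 1"
    and mon: "\<And>is js. length is + length js = n \<Longrightarrow> set is \<subseteq> {1..d} \<Longrightarrow> set js \<subseteq> {1..d} \<Longrightarrow>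
      is \<noteq> [] \<Longrightarrow> js \<noteq> [] \<Longrightarrow> pol (prod_list (map yv is) * prod_list (map zv js)) \<in> M"
  shows "G_comp d n \<subseteq> M"
proof
  fix f :: "'k galg" assume f: "f \<in> G_comp d n"
  interpret yz_subspace "{p. pol p \<in> M}"
    by (rule yz_subspace_pol[OF M])
  have "Poly_Mapping.single m (Poly_Mapping.lookup (snd f) m) \<in> {p. pol p \<in> M}"
    if m: "m \<in> Poly_Mapping.keys (snd f)" for m
  proof -
    obtain a b where ab: "m = (a, b)" by force
    have f': "snd f \<in> monomials_in d True True" "snd f \<in> homogeneous n"
      using f by (simp_all add: G_comp_iff G_carrier_iff)
    have *: "Poly_Mapping.keys a \<subseteq> {1..d}" "Poly_Mapping.keys b \<subseteq> {1..d}"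
      "mdeg a \<ge> 1" "mdeg b \<ge> 1" "mdeg a + mdeg b = n"
      unfolding mdeg_pos_iff using bspec[OF f'(1)[unfolded monomials_in_def mem_Collect_eq] m]
        bspec[OF f'(2)[unfolded homogeneous_def mem_Collect_eq] m]
      by (simp_all add: ab)
    obtain "is" where i: "length is = mdeg a" "set is \<subseteq> {1..d}"
      "Poly_Mapping.single (a, 0) (1::'k) = prod_list (map yv is)"
      using y_monomial_prod_list[OF refl *(1)] by blast
    obtain js where j: "length js = mdeg b" "set js \<subseteq> {1..d}"
      "Poly_Mapping.single (0, b) (1::'k) = prod_list (map zv js)"
      using z_monomial_prod_list[OF refl *(2)] by blast
    have "pol (prod_list (map yv is) * prod_list (map zv js)) \<in> M"
    proof (rule mon)
      show "length is + length js = n" "is \<noteq> []" "js \<noteq> []"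
        using i(1) j(1) *(3-5) by auto
    qed (use i j in auto)
    then have "Const (Poly_Mapping.lookup (snd f) m) *
        (Poly_Mapping.single (a, 0) (1::'k) * Poly_Mapping.single (0, b) 1) \<in> {p. pol p \<in> M}"
      using i(3) j(3) smult by auto
    then show ?thesis
      by (simp add: Const_def mult_single ab)
  qed
  then have "snd f \<in> {p. pol p \<in> M}"
    by (subst poly_mapping_sum_single) (rule sum)
  moreover have "f = pol (snd f)"
    using f \<open>n \<noteq> 1\<close> by (auto simp: G_comp_iff pol_def prod_eq_iff)
  ultimately show "f \<in> M" by simp
qed

lemma G_comp_2_subset:
  assumes "subspace_of (G d) M" "\<And>i j. {i, j} \<subseteq> {1..d} \<Longrightarrow> pol (yv i * zv j) \<in> M"
  shows "G_comp d 2 \<subseteq> M"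
proof (rule G_comp_subset[OF assms(1)])
  fix "is" js :: "nat list"
  assume *: "length is + length js = 2" "set is \<subseteq> {1..d}" "set js \<subseteq> {1..d}" "is \<noteq> []" "js \<noteq> []"
  then have "length is = 1 \<and> length js = 1"
    by (cases "is"; cases js) auto
  then show "pol (prod_list (map yv is) * prod_list (map zv js)) \<in> M"
    using * assms(2) by (auto simp: length_Suc_conv)
qed simp

lemma G_comp_3_subset:
  assumes "subspace_of (G d) M"
    and "\<And>i j k. {i, j, k} \<subseteq> {1..d} \<Longrightarrow> pol (yv i * yv j * zv k) \<in> M"
    and "\<And>i j k. {i, j, k} \<subseteq> {1..d} \<Longrightarrow> pol (yv i * zv j * zv k) \<in> M"
  shows "G_comp d 3 \<subseteq> M"
proof (rule G_comp_subset[OF assms(1)])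
  fix "is" js :: "nat list"
  assume *: "length is + length js = 3" "set is \<subseteq> {1..d}" "set js \<subseteq> {1..d}" "is \<noteq> []" "js \<noteq> []"
  then have "length is \<noteq> 0" "length js \<noteq> 0" by auto
  then have "length is = 2 \<and> length js = 1 \<or> length is = 1 \<and> length js = 2"
    using *(1) by arith
  then show "pol (prod_list (map yv is) * prod_list (map zv js)) \<in> M"
    using * assms(2,3) by (auto simp: length_Suc_conv numeral_2_eq_2 mult.assoc)
qed simp

lemma G_comp_4_subset:
  assumes "subspace_of (G d) M"
    and "\<And>i j k l. {i, j, k, l} \<subseteq> {1..d} \<Longrightarrow> pol (yv i * yv j * yv k * zv l) \<in> M"
    and "\<And>i j k l. {i, j, k, l} \<subseteq> {1..d} \<Longrightarrow> pol (yv i * yv j * zv k * zv l) \<in> M"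
    and "\<And>i j k l. {i, j, k, l} \<subseteq> {1..d} \<Longrightarrow> pol (yv i * zv j * zv k * zv l) \<in> M"
  shows "G_comp d 4 \<subseteq> M"
proof (rule G_comp_subset[OF assms(1)])
  fix "is" js :: "nat list"
  assume *: "length is + length js = 4" "set is \<subseteq> {1..d}" "set js \<subseteq> {1..d}" "is \<noteq> []" "js \<noteq> []"
  then have "length is \<noteq> 0" "length js \<noteq> 0" by auto
  then have "length is = 3 \<and> length js = 1 \<or> length is = 2 \<and> length js = 2 \<or>
      length is = 1 \<and> length js = 3"
    using *(1) by arith
  then show "pol (prod_list (map yv is) * prod_list (map zv js)) \<in> M"
  proof (elim disjE)
    assume "length is = 3 \<and> length js = 1"
    then obtain i j k l where "is = [i, j, k]" "js = [l]"
      by (auto simp: length_Suc_conv numeral_3_eq_3)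
    then show ?thesis using * assms(2)[of i j k l] by (simp add: mult.assoc)
  next
    assume "length is = 2 \<and> length js = 2"
    then obtain i j k l where "is = [i, j]" "js = [k, l]"
      by (auto simp: length_Suc_conv numeral_2_eq_2)
    then show ?thesis using * assms(3)[of i j k l] by (simp add: mult.assoc)
  next
    assume "length is = 1 \<and> length js = 3"
    then obtain i j k l where "is = [i]" "js = [j, k, l]"
      by (auto simp: length_Suc_conv numeral_3_eq_3)
    then show ?thesis using * assms(4)[of i j k l] by (simp add: mult.assoc)
  qed
qed simp

section \<open>Substitution endomorphisms and T-ideals of \<open>G d\<close>\<close>

lemma left_poly_gen [simp]: "left_poly (gen i) = yv i"
  and right_poly_gen [simp]: "right_poly (gen i) = zv i"
  by (simp_all add: left_poly_def right_poly_def gen_def Const_simps)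

lemma left_poly_in:
  fixes f :: "'k::field_char_0 galg"
  assumes "f \<in> G_carrier d"
  shows "left_poly f \<in> monomials_in d True False"
proof -
  have "Const c * yv i \<in> monomials_in d True False" if "i \<in> {1..d}" for i and c :: 'k
    using monomials_in_mult[OF monomials_in_Const monomials_in_yv[OF that]] by simp
  then show ?thesis
    using assms unfolding left_poly_def G_carrier_iff
    by (intro monomials_in_add monomials_in_sum) (blast, auto elim: monomials_in_mono)
qed

lemma right_poly_in:
  fixes f :: "'k::field_char_0 galg"
  assumes "f \<in> G_carrier d"
  shows "right_poly f \<in> monomials_in d False True"
proof -
  have "Const c * zv i \<in> monomials_in d False True" if "i \<in> {1..d}" for i and c :: 'k
    using monomials_in_mult[OF monomials_in_Const monomials_in_zv[OF that]] by simp
  then show ?thesis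
    using assms unfolding right_poly_def G_carrier_iff
    by (intro monomials_in_add monomials_in_sum) (blast, auto elim: monomials_in_mono)
qed

lemma pol_in_G_carrier [simp]: "pol p \<in> G_carrier d \<longleftrightarrow> p \<in> monomials_in d True True"
  by (simp add: G_carrier_iff pol_def)

lemma gmul_closed: "f \<in> G_carrier d \<Longrightarrow> g \<in> G_carrier d \<Longrightarrow> gmul f g \<in> G_carrier d"
  using monomials_in_mult[OF left_poly_in right_poly_in, of f d g] by (simp add: gmul_def)

lemma gen_in_G_carrier [simp]: "i \<in> {1..d} \<Longrightarrow> gen i \<in> G_carrier d"
  by (simp add: G_carrier_iff gen_def monomials_in_zero)

text \<open>The endomorphism of the free algebra with x_j sent to \<open>h j\<close>. In a monomial
  y_j stems from x_j as a left factor and z_j from x_j as a right factor, which explains the two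
  different substitutions. As \<open>h\<close> is total, it must have values in the carrier at all
  indices, also beyond \<open>d\<close>.\<close>

definition gsubst :: "(nat \<Rightarrow> 'k::field_char_0 galg) \<Rightarrow> 'k galg \<Rightarrow> 'k galg" where
  "gsubst h f = (\<Sum>j\<in>Poly_Mapping.keys (fst f). gscale (Poly_Mapping.lookup (fst f) j) (h j)) +
     pol (psubst (\<lambda>j. left_poly (h j)) (\<lambda>j. right_poly (h j)) (snd f))"

lemma left_poly_sum: "left_poly (\<Sum>i\<in>A. f i) = (\<Sum>i\<in>A. left_poly (f i))"
  by (induction A rule: infinite_finite_induct) (use left_poly_pol[of 0] in \<open>simp_all add: left_poly_add\<close>)

lemma right_poly_sum: "right_poly (\<Sum>i\<in>A. f i) = (\<Sum>i\<in>A. right_poly (f i))"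
  by (induction A rule: infinite_finite_induct) (use right_poly_pol[of 0] in \<open>simp_all add: right_poly_add\<close>)

lemma gsubst_pol: "gsubst h (pol p) = pol (psubst (\<lambda>j. left_poly (h j)) (\<lambda>j. right_poly (h j)) p)"
  by (simp add: gsubst_def pol_def flip: zero_prod_def)

lemma gsubst_add: "gsubst h (f + g) = gsubst h f + gsubst h g"
  unfolding gsubst_def fst_add snd_add psubst_add
  by (subst sum_keys_add) (auto simp: gscale_add_left pol_add algebra_simps)

lemma gsubst_scale: "gsubst h (gscale c f) = gscale c (gsubst h f)"
proof -
  have "(\<Sum>j\<in>Poly_Mapping.keys (fst (gscale c f)). gscale (Poly_Mapping.lookup (fst (gscale c f)) j) (h j)) =
     (\<Sum>j\<in>Poly_Mapping.keys (fst f). gscale (c * Poly_Mapping.lookup (fst f) j) (h j))"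
    unfolding gscale_def[of c] fst_conv by (rule sum_keys_scale) simp
  then show ?thesis
    by (simp add: gsubst_def gscale_add_right gscale_sum gscale_gscale gscale_pol)
       (simp add: gscale_def map_scale_eq psubst_mult psubst_Const)
qed

text \<open>Products depend only on left and right polynomials, so this and its right analogue
  reduce multiplicativity of \<open>gsubst\<close> to that of \<open>psubst\<close>.\<close>

lemma left_poly_gsubst:
  "left_poly (gsubst h f) = psubst (\<lambda>j. left_poly (h j)) (\<lambda>j. right_poly (h j)) (left_poly f)"
  by (simp add: gsubst_def left_poly_add left_poly_sum left_poly_scale)
     (simp add: left_poly_def[of f] psubst_add psubst_sum psubst_mult psubst_Const psubst_yv)

lemma right_poly_gsubst:
  "right_poly (gsubst h f) = psubst (\<lambda>j. left_poly (h j)) (\<lambda>j. right_poly (h j)) (right_poly f)"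
  by (simp add: gsubst_def right_poly_add right_poly_sum right_poly_scale)
     (simp add: right_poly_def[of f] psubst_add psubst_sum psubst_mult psubst_Const psubst_zv)

lemma gsubst_mult: "gsubst h (gmul f g) = gmul (gsubst h f) (gsubst h g)"
  by (simp add: gmul_def gsubst_pol left_poly_gsubst right_poly_gsubst psubst_mult)

lemma gsubst_closed:
  assumes h: "\<And>i. h i \<in> G_carrier d" and f: "f \<in> G_carrier d"
  shows "gsubst h f \<in> G_carrier d"
proof -
  let ?u = "\<lambda>j. left_poly (h j)" and ?v = "\<lambda>j. right_poly (h j)"
  have "Const (Poly_Mapping.lookup (snd f) m) * mon_subst ?u (fst m) * mon_subst ?v (snd m)
      \<in> monomials_in d True True" if "m \<in> Poly_Mapping.keys (snd f)" for m
  proof -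
    have "fst m \<noteq> 0" "snd m \<noteq> 0"
      using f that by (auto simp: G_carrier_iff monomials_in_def)
    then show ?thesis
      using monomials_in_mult[OF monomials_in_mult[OF monomials_in_Const
          monomials_in_mon_subst[of ?u, OF left_poly_in[OF h], of "fst m"]]
          monomials_in_mon_subst[of ?v, OF right_poly_in[OF h], of "snd m"]]
      by simp
  qed
  then have "pol (psubst ?u ?v (snd f)) \<in> G_carrier d"
    by (auto simp: psubst_alt intro: monomials_in_sum)
  moreover have "(\<Sum>j\<in>A. gscale (c j) (h j)) \<in> G_carrier d" for A c
    using subspace_G_carrier[of d] h by (intro subspace_G_sum subspace_G_D(3))
  ultimately show ?thesis
    unfolding gsubst_def by (intro subspace_G_D(2)[OF subspace_G_carrier])
qed

lemma endomorphism_gsubst: "(\<And>i. h i \<in> G_carrier d) \<Longrightarrow> endomorphism_of (G d) (gsubst h)"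
  by (simp add: endomorphism_of_def G_def gsubst_closed gsubst_add gsubst_scale gsubst_mult)

lemma T_ideal_G_D:
  assumes "T_ideal (G d) J"
  shows "subspace_of (G d) J"
    and "\<And>f g. f \<in> J \<Longrightarrow> g \<in> G_carrier d \<Longrightarrow> gmul f g \<in> J"
    and "\<And>f g. f \<in> J \<Longrightarrow> g \<in> G_carrier d \<Longrightarrow> gmul g f \<in> J"
    and "\<And>f h. f \<in> J \<Longrightarrow> (\<And>i. h i \<in> G_carrier d) \<Longrightarrow> gsubst h f \<in> J"
    and "\<And>f \<phi>. f \<in> J \<Longrightarrow> endomorphism_of (G d) \<phi> \<Longrightarrow> \<phi> f \<in> J"
proof -
  show "subspace_of (G d) J" "\<And>f g. f \<in> J \<Longrightarrow> g \<in> G_carrier d \<Longrightarrow> gmul f g \<in> J"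
    "\<And>f g. f \<in> J \<Longrightarrow> g \<in> G_carrier d \<Longrightarrow> gmul g f \<in> J"
    using assms unfolding T_ideal_def ideal_of_def G_def by simp_all
  show endo: "\<phi> f \<in> J" if "f \<in> J" "endomorphism_of (G d) \<phi>" for f \<phi>
    using assms that unfolding T_ideal_def by blast
  show "gsubst h f \<in> J" if "f \<in> J" "\<And>i. h i \<in> G_carrier d" for f h
    using endo[OF that(1) endomorphism_gsubst] that(2) by blast
qed

lemma T_ideal_iff:
  "T_ideal A I \<longleftrightarrow> I \<subseteq> carrier A \<and> zero A \<in> I \<and> (\<forall>x\<in>I. \<forall>y\<in>I. add A x y \<in> I) \<and>
     (\<forall>c. \<forall>x\<in>I. scale A c x \<in> I) \<and> (\<forall>x\<in>I. \<forall>a\<in>carrier A. mult A a x \<in> I \<and> mult A x a \<in> I) \<and>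
     (\<forall>\<phi>. endomorphism_of A \<phi> \<longrightarrow> (\<forall>x\<in>I. \<phi> x \<in> I))"
  unfolding T_ideal_def ideal_of_def subspace_of_def image_subset_iff by (simp add: conj_assoc)

text \<open>The given T-ideal \<open>I\<close> makes the intersected family nonempty and so keeps
  the intersection inside the carrier; the closure properties pass to intersections.\<close>

lemma T_ideal_gen_T_ideal:
  assumes "T_ideal A I" "S \<subseteq> I"
  shows "T_ideal A (T_ideal_gen A S)"
proof -
  have T: "x \<in> T_ideal_gen A S \<longleftrightarrow> (\<forall>J. T_ideal A J \<longrightarrow> S \<subseteq> J \<longrightarrow> x \<in> J)" for x
    by (auto simp: T_ideal_gen_def)
  show ?thesis
    unfolding T_ideal_iff[of A "T_ideal_gen A S"]
  proof (intro conjI ballI allI impI subsetI)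
    show "x \<in> carrier A" if "x \<in> T_ideal_gen A S" for x
      using that assms unfolding T T_ideal_iff by blast
  qed (simp_all add: T, simp_all add: T_ideal_iff)
qed

lemma T_ideal_G_carrier: "T_ideal (G d) (G_carrier d)"
proof -
  have "\<phi> ` G_carrier d \<subseteq> G_carrier d" if "endomorphism_of (G d) \<phi>" for \<phi> :: "'a galg \<Rightarrow> 'a galg"
    using that unfolding endomorphism_of_def G_def by auto
  moreover have "carrier (G d) = G_carrier d" "mult (G d) = gmul"
    by (simp_all add: G_def)
  ultimately show ?thesis
    unfolding T_ideal_def ideal_of_def using subspace_G_carrier[of d] gmul_closed by metis
qed

lemma psubst_diff: "psubst u v (p - q) = psubst u v p - psubst u v q"
  using psubst_add[of u v "p - q" q] by simp

lemma psubst_power: "psubst u v (p ^ n) = psubst u v p ^ n"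
  using psubst_Const[of u v 1] by (induction n) (simp_all add: psubst_mult Const_simps)

lemmas psubst_simps = psubst_add psubst_diff psubst_mult psubst_power psubst_Const psubst_yv psubst_zv

lemma yz_in_monomials:
  "i \<in> {1..d} \<Longrightarrow> j \<in> {1..d} \<Longrightarrow> yv i * zv j \<in> monomials_in d True True"
  using monomials_in_mult[OF monomials_in_yv monomials_in_zv] by simp

lemma T_ideal_gen_superset: "S \<subseteq> T_ideal_gen A S"
  by (auto simp: T_ideal_gen_def)

section \<open>The T-ideal of \<open>\<UU>\<close>-type identities: substitutions, polarizations,
  degree 4\<close>

lemma T_ideal_U_ideal:
  assumes "d \<ge> 1"
  shows "T_ideal (G d) (U_ideal d \<alpha>\<^sub>1 \<alpha>\<^sub>2)"
proof -
  have yz: "Const c * (yv 1 * zv 1) \<in> monomials_in d True True" for c :: 'a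
    using monomials_in_mult[OF monomials_in_Const yz_in_monomials, of 1 d 1 c] assms by simp
  have "Const \<alpha>\<^sub>1 * (yv 1 * zv 1) * yv 1 + Const \<alpha>\<^sub>2 * (yv 1 * zv 1) * zv 1 \<in> monomials_in d True True"
    using monomials_in_mult[OF yz monomials_in_yv, of 1 \<alpha>\<^sub>1] monomials_in_mult[OF yz monomials_in_zv, of 1 \<alpha>\<^sub>2]
      assms by (intro monomials_in_add) auto
  then show ?thesis
    unfolding U_ideal_def
    by (intro T_ideal_gen_T_ideal[OF T_ideal_G_carrier])
       (simp add: power2_eq_square mult_ac)
qed

lemma U_ideal_identity:
  assumes "d \<ge> 1" "f \<in> G_carrier d"
  shows "pol (Const \<alpha>\<^sub>1 * (left_poly f)\<^sup>2 * right_poly f + Const \<alpha>\<^sub>2 * left_poly f * (right_poly f)\<^sup>2)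
    \<in> U_ideal d \<alpha>\<^sub>1 \<alpha>\<^sub>2"
proof -
  \<comment> \<open>Only x_1 occurs in the generator, so the constant assignment suffices and lies
    in the carrier at every index.\<close>
  have "gsubst (\<lambda>_. f) (pol (Const \<alpha>\<^sub>1 * (yv 1)\<^sup>2 * zv 1 + Const \<alpha>\<^sub>2 * yv 1 * (zv 1)\<^sup>2)) \<in> U_ideal d \<alpha>\<^sub>1 \<alpha>\<^sub>2"
    using assms by (intro T_ideal_G_D(4)[OF T_ideal_U_ideal])
      (simp_all add: U_ideal_def T_ideal_gen_superset[THEN subsetD])
  then show ?thesis
    by (simp add: gsubst_pol psubst_simps)
qed

text \<open>The identity is a cubic form in the substituted element, so inclusion-exclusion over the
  sums of \<open>f\<close>, \<open>g\<close>, \<open>h\<close> extracts its multilinear part. The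
  squares produce a factor 2, which characteristic 0 cancels.\<close>

lemma U_ideal_polarized:
  assumes "d \<ge> 1" "f \<in> G_carrier d" "g \<in> G_carrier d" "h \<in> G_carrier d"
  shows "pol (Const \<alpha>\<^sub>1 * (left_poly f * left_poly g * right_poly h +
      left_poly f * left_poly h * right_poly g + left_poly g * left_poly h * right_poly f) +
    Const \<alpha>\<^sub>2 * (left_poly f * right_poly g * right_poly h +
      left_poly g * right_poly f * right_poly h + left_poly h * right_poly f * right_poly g))
    \<in> U_ideal d \<alpha>\<^sub>1 \<alpha>\<^sub>2" (is "pol ?P \<in> ?I")
proof -
  interpret yz_subspace "{p. pol p \<in> ?I}"
    by (rule yz_subspace_pol[OF T_ideal_G_D(1)[OF T_ideal_U_ideal[OF assms(1)]]])
  define F where "F l r = Const \<alpha>\<^sub>1 * l\<^sup>2 * r + Const \<alpha>\<^sub>2 * l * r\<^sup>2" for l r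
  have F: "F (left_poly f) (right_poly f) \<in> {p. pol p \<in> ?I}" if "f \<in> G_carrier d" for f
    using U_ideal_identity[OF assms(1) that] by (simp add: F_def)
  have C: "f + g \<in> G_carrier d" if "f \<in> G_carrier d" "g \<in> G_carrier d" for f g :: "'a galg"
    using subspace_G_D(2)[OF subspace_G_carrier that] .
  have "2 * ?P = F (left_poly (f + g + h)) (right_poly (f + g + h)) -
      F (left_poly (f + g)) (right_poly (f + g)) - F (left_poly (f + h)) (right_poly (f + h)) -
      F (left_poly (g + h)) (right_poly (g + h)) + F (left_poly f) (right_poly f) +
      F (left_poly g) (right_poly g) + F (left_poly h) (right_poly h)"
    unfolding F_def left_poly_add right_poly_add by (simp add: algebra_simps power2_eq_square)
  also have "\<dots> \<in> {p. pol p \<in> ?I}"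
    by (intro closed F C assms)
  finally show ?thesis
    using cancel_numeral by blast
qed

lemma T_ideal_yz_mult:
  assumes "T_ideal (G d) J" "pol p \<in> J" "i \<in> {1..d}"
  shows "pol (yv i * p) \<in> J" "pol (p * zv i) \<in> J"
  using T_ideal_G_D(2,3)[OF assms(1,2) gen_in_G_carrier[OF assms(3)]] by (simp_all add: gmul_table)

text \<open>Two kinds of polarization supply the linear system: at three generators, then multiplied
  by one more generator on the left or on the right, and at two generators and one product.\<close>

lemma U_ideal_degree_4:
  fixes \<alpha>\<^sub>1 \<alpha>\<^sub>2 :: "'k::field_char_0"
  assumes "d \<ge> 1" "\<alpha>\<^sub>1 \<noteq> 0" "\<alpha>\<^sub>2 \<noteq> 0" "\<alpha>\<^sub>1 + \<alpha>\<^sub>2 \<noteq> 0" "\<alpha>\<^sub>1 \<noteq> \<alpha>\<^sub>2"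
  shows "G_comp d 4 \<subseteq> U_ideal d \<alpha>\<^sub>1 \<alpha>\<^sub>2"
proof -
  let ?I = "U_ideal d \<alpha>\<^sub>1 \<alpha>\<^sub>2"
  have T: "T_ideal (G d) ?I"
    by (rule T_ideal_U_ideal[OF assms(1)])
  interpret yz_subspace "{p. pol p \<in> ?I}"
    by (rule yz_subspace_pol[OF T_ideal_G_D(1)[OF T]])
  have P: "pol (Const \<alpha>\<^sub>1 * (yv i * yv j * zv k + yv i * yv k * zv j + yv j * yv k * zv i) +
      Const \<alpha>\<^sub>2 * (yv i * zv j * zv k + yv j * zv i * zv k + yv k * zv i * zv j)) \<in> ?I"
    if "{i, j, k} \<subseteq> {1..d}" for i j k
    using U_ideal_polarized[OF assms(1), of "gen i" "gen j" "gen k" \<alpha>\<^sub>1 \<alpha>\<^sub>2] that by simp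
  \<comment> \<open>The product y_m z_n is its own left and right polynomial, hence a common factor
    of all six terms.\<close>
  have Q: "pol (yv m * zv n * (Const \<alpha>\<^sub>1 * yv i * yv j +
      (Const \<alpha>\<^sub>1 + Const \<alpha>\<^sub>2) * (yv i * zv j + yv j * zv i) + Const \<alpha>\<^sub>2 * zv i * zv j)) \<in> ?I"
    if "{m, n, i, j} \<subseteq> {1..d}" for m n i j
    using U_ideal_polarized[OF assms(1), of "gen i" "gen j" "pol (yv m * zv n)" \<alpha>\<^sub>1 \<alpha>\<^sub>2] that
      yz_in_monomials[of m d n]
    by (simp add: algebra_simps)
  have *: "yv i * yv j * yv k * zv l \<in> {p. pol p \<in> ?I}" "yv i * yv j * zv k * zv l \<in> {p. pol p \<in> ?I}"
    "yv i * zv j * zv k * zv l \<in> {p. pol p \<in> ?I}" if "{i, j, k, l} \<subseteq> {1..d}" for i j k l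
    using that
    by (intro quartic_monomials[where D = "{1..d}" and y = yv and z = zv, OF assms(2-5)];
        use P Q T_ideal_yz_mult[OF T] in simp)+
  show ?thesis
    using * by (intro G_comp_4_subset T_ideal_G_D(1)[OF T]) auto
qed

section \<open>T-ideals containing a nonzero form of degree 1 or 2\<close>

lemma T_ideal_degree_1:
  assumes J: "T_ideal (G d) J" and f: "f \<in> J" "f \<in> G_comp d 1" "f \<noteq> 0"
  shows "G_comp d 2 \<subseteq> J"
proof -
  note S = T_ideal_G_D(1)[OF J]
  \<comment> \<open>Monomials of the carrier contain at least one y and one z, so none has degree
    1.\<close>
  have "snd f = 0"
  proof (rule ccontr)
    assume "snd f \<noteq> 0"
    then obtain m where "m \<in> Poly_Mapping.keys (snd f)"
      by (metis all_not_in_conv keys_eq_empty)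
    with f(2) show False
      by (fastforce simp: G_comp_def G_carrier_def)
  qed
  with f(3) have "fst f \<noteq> 0"
    by (simp add: prod_eq_iff)
  then obtain i where i: "i \<in> Poly_Mapping.keys (fst f)"
    by (metis all_not_in_conv keys_eq_empty)
  have gen: "gen j \<in> J" if j: "j \<in> {1..d}" for j
  proof -
    \<comment> \<open>Sending x_i to x_j and all other generators to 0 turns the linear form into
      the nonzero multiple c x_j, so \<open>J\<close> contains every generator.\<close>
    define h where "h = (\<lambda>k. if k = i then gen j else (0 :: 'a galg))"
    define c where "c = Poly_Mapping.lookup (fst f) i"
    have "gsubst h f \<in> J"
      using j by (intro T_ideal_G_D(4)[OF J f(1)])
        (simp add: h_def subspace_G_D(1)[OF subspace_G_carrier])
    also have "gsubst h f = (\<Sum>k\<in>Poly_Mapping.keys (fst f).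
        if k = i then gscale (Poly_Mapping.lookup (fst f) i) (gen j) else 0)"
      unfolding gsubst_def \<open>snd f = 0\<close> psubst_zero pol_0 add_0_right
      by (intro sum.cong) (auto simp: h_def)
    also have "\<dots> = gscale c (gen j)"
      using i by (simp add: c_def)
    finally have "gscale (inverse c) (gscale c (gen j)) \<in> J"
      by (rule subspace_G_D(3)[OF S])
    then show ?thesis
      using i by (simp add: gscale_gscale c_def in_keys_iff)
  qed
  show ?thesis
    using T_ideal_G_D(2)[OF J gen gen_in_G_carrier] by (intro G_comp_2_subset[OF S]) (simp add: gmul_table)
qed

text \<open>y_1 z_1 is the square of x_1, so \<open>J\<close> contains all squares and, by
  polarization, all y_i z_j + y_j z_i. Multiplying by y_k from the left and by z_k from the right
  gives the pairwise sums in both bidegrees.\<close>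

lemma T_ideal_symmetric:
  assumes J: "T_ideal (G d) J" and p: "pol (yv 1 * zv 1) \<in> J"
  shows "G_comp d 3 \<subseteq> J"
proof -
  note S = T_ideal_G_D(1)[OF J]
  interpret yz_subspace "{p. pol p \<in> J}"
    by (rule yz_subspace_pol[OF S])
  have F: "left_poly f * right_poly f \<in> {p. pol p \<in> J}" if "f \<in> G_carrier d" for f
    using T_ideal_G_D(4)[OF J p, of "\<lambda>_. f"] that by (simp add: gsubst_pol psubst_simps)
  have sym: "yv i * zv j + yv j * zv i \<in> {p. pol p \<in> J}" if "{i, j} \<subseteq> {1..d}" for i j
  proof -
    have g: "gen i \<in> G_carrier d" "gen j \<in> G_carrier d"
      using that by simp_all
    with subspace_G_D(2)[OF subspace_G_carrier g] have "left_poly (gen i + gen j) * right_poly (gen i + gen j) -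
        left_poly (gen i) * right_poly (gen i) - left_poly (gen j) * right_poly (gen j)
        \<in> {p. pol p \<in> J}"
      by (intro closed F)
    then show ?thesis
      by (simp add: left_poly_add right_poly_add algebra_simps)
  qed
  have *: "yv i * yv j * zv k \<in> {p. pol p \<in> J}" "zv i * zv j * yv k \<in> {p. pol p \<in> J}"
    if "{i, j, k} \<subseteq> {1..d}" for i j k
  proof -
    show "yv i * yv j * zv k \<in> {p. pol p \<in> J}"
      using that T_ideal_yz_mult(1)[OF J] sym
      by (intro cubic_monomials_of_sym[where D = "{1..d}"]) auto
    show "zv i * zv j * yv k \<in> {p. pol p \<in> J}"
    \<comment> \<open>Here the lemma is used with the roles of y and z exchanged.\<close>
    proof (rule cubic_monomials_of_sym[where D = "{1..d}"])
      show "zv k * (zv i * yv j + zv j * yv i) \<in> {p. pol p \<in> J}" if "{i, j, k} \<subseteq> {1..d}" for i j k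
        using T_ideal_yz_mult(2)[OF J, of "yv j * zv i + yv i * zv j" k] sym[of j i] that
        by (simp add: algebra_simps)
    qed (rule that)
  qed
  show ?thesis
    using * by (intro G_comp_3_subset[OF S]) (auto simp: mult_ac)
qed

text \<open>The skew element is the commutator of x_1 and x_2, so \<open>J\<close> contains all
  commutators. Taken at two generators and at a generator and a product, they make all multilinear
  cubic monomials congruent, and the defining identity then removes them because alpha_1 + alpha_2
  \<noteq> 0.\<close>

lemma T_ideal_skew:
  assumes "d \<ge> 1" and J: "T_ideal (G d) J" and U: "U_ideal d \<alpha>\<^sub>1 \<alpha>\<^sub>2 \<subseteq> J" and "\<alpha>\<^sub>1 + \<alpha>\<^sub>2 \<noteq> 0"
    and p: "pol (yv 1 * zv 2 - yv 2 * zv 1) \<in> J"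
  shows "G_comp d 3 \<subseteq> J"
proof -
  note S = T_ideal_G_D(1)[OF J]
  interpret yz_subspace "{p. pol p \<in> J}"
    by (rule yz_subspace_pol[OF S])
  have F: "pol (left_poly f * right_poly g - left_poly g * right_poly f) \<in> J"
    if "f \<in> G_carrier d" "g \<in> G_carrier d" for f g
    using T_ideal_G_D(4)[OF J p, of "\<lambda>i. if i = 1 then f else g"] that
    by (simp add: gsubst_pol psubst_simps)
  have P: "pol (Const \<alpha>\<^sub>1 * (yv i * yv j * zv k + yv i * yv k * zv j + yv j * yv k * zv i) +
      Const \<alpha>\<^sub>2 * (yv i * zv j * zv k + yv j * zv i * zv k + yv k * zv i * zv j)) \<in> J"
    if "{i, j, k} \<subseteq> {1..d}" for i j k
    using U_ideal_polarized[OF assms(1), of "gen i" "gen j" "gen k" \<alpha>\<^sub>1 \<alpha>\<^sub>2] that U by auto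
  have A: "pol (yv k * (yv i * zv j - yv j * zv i)) \<in> J" if "{i, j, k} \<subseteq> {1..d}" for i j k
    using F[of "gen i" "gen j"] that T_ideal_yz_mult(1)[OF J] by simp
  \<comment> \<open>The commutator of x_i with the product y_j z_k is y_i y_j z_k - y_j z_k
    z_i.\<close>
  have B: "pol (yv j * zv k * (yv i - zv i)) \<in> J" if "{i, j, k} \<subseteq> {1..d}" for i j k
    using F[of "gen i" "pol (yv j * zv k)"] that yz_in_monomials[of j d k] by (simp add: algebra_simps)
  have *: "yv i * yv j * zv k \<in> {p. pol p \<in> J}" "yv i * zv j * zv k \<in> {p. pol p \<in> J}"
    if "{i, j, k} \<subseteq> {1..d}" for i j k
    using that
    by (intro cubic_monomials_of_skew[where D = "{1..d}" and y = yv and z = zv, OF assms(4)];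
        use P A B in simp)+
  show ?thesis
    using * by (intro G_comp_3_subset[OF S]) auto
qed

lemma mdeg_1_single:
  assumes "mdeg c = 1"
  shows "\<exists>i\<in>Poly_Mapping.keys c. c = Poly_Mapping.single i 1"
proof -
  from assms have "mdeg c = Suc 0" by simp
  then obtain i c' where "c = Poly_Mapping.single i 1 + c'" "mdeg c' = 0" "i \<in> Poly_Mapping.keys c"
    by (rule mdeg_Suc_decompose)
  moreover from this have "c' = 0"
    using mdeg_pos_iff[of c'] by auto
  ultimately show ?thesis by auto
qed

text \<open>Both exponents of a monomial are nonzero, so in degree 2 each has degree 1. Thus the
  element is a bilinear form given by its coefficient matrix, which makes substitutions easy to
  evaluate.\<close>

lemma G_comp_2_expand:
  fixes f :: "'k::field_char_0 galg"
  assumes "f \<in> G_comp d 2"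
  defines "c i j \<equiv> Poly_Mapping.lookup (snd f) (Poly_Mapping.single i 1, Poly_Mapping.single j 1)"
  shows "f = pol (\<Sum>(i, j)\<in>{1..d} \<times> {1..d}. Const (c i j) * yv i * zv j)"
proof -
  let ?e = "\<lambda>(i, j). (Poly_Mapping.single i (1::nat), Poly_Mapping.single j (1::nat))"
  have inj: "inj_on ?e A" for A :: "(nat \<times> nat) set"
    by (auto simp: inj_on_def dest: arg_cong[of _ _ Poly_Mapping.keys])
  have "Poly_Mapping.keys (snd f) \<subseteq> ?e ` ({1..d} \<times> {1..d})"
  proof
    fix m assume m: "m \<in> Poly_Mapping.keys (snd f)"
    obtain a b where ab: "m = (a, b)" by force
    have f': "snd f \<in> monomials_in d True True" "snd f \<in> homogeneous 2"
      using assms(1) by (simp_all add: G_comp_iff G_carrier_iff)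
    have *: "Poly_Mapping.keys a \<subseteq> {1..d}" "Poly_Mapping.keys b \<subseteq> {1..d}"
      "mdeg a \<ge> 1" "mdeg b \<ge> 1" "mdeg a + mdeg b = 2"
      unfolding mdeg_pos_iff using bspec[OF f'(1)[unfolded monomials_in_def mem_Collect_eq] m]
        bspec[OF f'(2)[unfolded homogeneous_def mem_Collect_eq] m]
      by (simp_all add: ab)
    then obtain i j where "i \<in> {1..d}" "j \<in> {1..d}" "a = Poly_Mapping.single i 1" "b = Poly_Mapping.single j 1"
      using mdeg_1_single[of a] mdeg_1_single[of b] by force
    then show "m \<in> ?e ` ({1..d} \<times> {1..d})"
      by (auto simp: ab intro!: image_eqI[of _ _ "(i, j)"])
  qed
  then have "snd f = (\<Sum>m\<in>?e ` ({1..d} \<times> {1..d}). Poly_Mapping.single m (Poly_Mapping.lookup (snd f) m))"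
    by (subst poly_mapping_sum_single, intro sum.mono_neutral_left) (auto simp: in_keys_iff)
  also have "\<dots> = (\<Sum>(i, j)\<in>{1..d} \<times> {1..d}. Const (c i j) * yv i * zv j)"
    by (subst sum.reindex[OF inj]) (auto intro!: sum.cong simp: c_def Const_def yv_def zv_def mult_single)
  finally have "snd f = (\<Sum>(i, j)\<in>{1..d} \<times> {1..d}. Const (c i j) * yv i * zv j)" .
  moreover have "fst f = 0"
    using assms(1) by (auto simp: G_comp_iff)
  ultimately show ?thesis
    by (simp add: pol_def prod_eq_iff)
qed

text \<open>Restrict the bilinear form to two generators x_i, x_j. If \<open>J\<close> does not
  contain y_1 z_1, every coefficient of y_1 z_1 obtained by substitution vanishes; this makes the
  restricted form alternating, hence a nonzero multiple of the skew element.\<close>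

lemma T_ideal_degree_2:
  fixes f :: "'k::field_char_0 galg"
  assumes "d \<ge> 2" and J: "T_ideal (G d) J" and U: "U_ideal d \<alpha>\<^sub>1 \<alpha>\<^sub>2 \<subseteq> J" and "\<alpha>\<^sub>1 + \<alpha>\<^sub>2 \<noteq> 0"
    and f: "f \<in> J" "f \<in> G_comp d 2" "f \<noteq> 0"
  shows "G_comp d 3 \<subseteq> J"
proof -
  interpret yz_subspace "{p. pol p \<in> J}"
    by (rule yz_subspace_pol[OF T_ideal_G_D(1)[OF J]])
  define c where "c i j = Poly_Mapping.lookup (snd f) (Poly_Mapping.single i 1, Poly_Mapping.single j 1)" for i j
  have f_eq: "f = pol (\<Sum>(i, j)\<in>{1..d} \<times> {1..d}. Const (c i j) * yv i * zv j)"
    unfolding c_def by (rule G_comp_2_expand[OF f(2)])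
  have "\<exists>i\<in>{1..d}. \<exists>j\<in>{1..d}. c i j \<noteq> 0"
  proof (rule ccontr)
    assume "\<not> ?thesis"
    then have "(\<Sum>(i, j)\<in>{1..d} \<times> {1..d}. Const (c i j) * yv i * zv j) = 0"
      by (intro sum.neutral) (auto simp: Const_simps)
    with f_eq f(3) show False by simp
  qed
  then obtain i k where ik: "i \<in> {1..d}" "k \<in> {1..d}" "c i k \<noteq> 0"
    by blast
  \<comment> \<open>A nonzero entry c_ik either lies off the diagonal, and then j = k, or on it, and
    then j may be any other index; one exists because \<open>d \<ge> 2\<close>.\<close>
  obtain b where "b \<in> {1..d}" "b \<noteq> i"
    using \<open>d \<ge> 2\<close> that[of 1] that[of 2] by (cases "i = 1") auto
  with ik obtain j where ij: "i \<in> {1..d}" "j \<in> {1..d}" "i \<noteq> j" "c i i \<noteq> 0 \<or> c i j \<noteq> 0"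
    by (cases "i = k") auto
  have sub: "pol (Const (c i i) * left_poly g * right_poly g + Const (c i j) * left_poly g * right_poly h +
      Const (c j i) * left_poly h * right_poly g + Const (c j j) * left_poly h * right_poly h) \<in> J"
    if "g \<in> G_carrier d" "h \<in> G_carrier d" for g h
  proof -
    \<comment> \<open>All generators other than x_i and x_j go to 0, so only a 2 by 2 block of the
      matrix survives.\<close>
    define s where "s k = (if k = i then g else if k = j then h else 0)" for k
    have s: "s k \<in> G_carrier d" for k
      using that by (simp add: s_def subspace_G_D(1)[OF subspace_G_carrier])
    have "gsubst s f = pol (\<Sum>(k, l)\<in>{1..d} \<times> {1..d}. Const (c k l) * left_poly (s k) * right_poly (s l))"
      unfolding f_eq gsubst_pol psubst_sum split_def psubst_simps ..
    also have "(\<Sum>(k, l)\<in>{1..d} \<times> {1..d}. Const (c k l) * left_poly (s k) * right_poly (s l)) =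
        (\<Sum>(k, l)\<in>{i, j} \<times> {i, j}. Const (c k l) * left_poly (s k) * right_poly (s l))"
      using ij left_poly_pol[of "0 :: 'k yz_poly"] right_poly_pol[of "0 :: 'k yz_poly"]
      by (intro sum.mono_neutral_right) (auto simp: s_def split: if_splits)
    also have "\<dots> = Const (c i i) * left_poly g * right_poly g + Const (c i j) * left_poly g * right_poly h +
        Const (c j i) * left_poly h * right_poly g + Const (c j j) * left_poly h * right_poly h"
      using ij(3) by (simp add: s_def flip: sum.cartesian_product)
    finally show ?thesis
      using T_ideal_G_D(4)[OF J f(1), of s, OF s] by simp
  qed
  have zero_lr: "left_poly 0 = (0 :: 'k yz_poly)" "right_poly 0 = (0 :: 'k yz_poly)"
    using left_poly_pol[of 0] right_poly_pol[of 0] by simp_all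
  have g: "gen 1 \<in> G_carrier d" "gen 2 \<in> G_carrier d" "0 \<in> G_carrier d"
    using \<open>d \<ge> 2\<close> subspace_G_D(1)[OF subspace_G_carrier] by simp_all
  show ?thesis
  proof (cases "pol (yv 1 * zv 1 :: 'k yz_poly) \<in> J")
    case True
    then show ?thesis by (rule T_ideal_symmetric[OF J])
  next
    case False
    then have zero: "e = 0" if "Const e * (yv 1 * zv 1) \<in> {p. pol p \<in> J}" for e
      using cancel[OF that] by auto
    have "c i i = 0"
      \<comment> \<open>The pairs (x_1, 0), (0, x_1) and (x_1, x_1) produce c_ii, c_jj and the sum
        of all four entries as coefficients of y_1 z_1.\<close>
      using sub[of "gen 1" 0] g by (intro zero) (simp add: zero_lr mult.assoc)
    moreover have "c j j = 0"
      using sub[of 0 "gen 1"] g by (intro zero) (simp add: zero_lr mult.assoc)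
    moreover have "c i i + c i j + c j i + c j j = 0"
      using sub[of "gen 1" "gen 1"] g by (intro zero) (simp add: Const_simps algebra_simps)
    ultimately have *: "c i i = 0" "c j j = 0" "c j i = - c i j"
      by (auto simp: add_eq_0_iff)
    have "Const (c i j) * (yv 1 * zv 2 - yv 2 * zv 1) \<in> {p. pol p \<in> J}"
      using sub[of "gen 1" "gen 2"] g by (simp add: * Const_simps Const_minus algebra_simps)
    with ij(4) *(1) have "pol (yv 1 * zv 2 - yv 2 * zv 1) \<in> J"
      using cancel by auto
    then show ?thesis
      using T_ideal_skew[OF _ J U assms(4)] \<open>d \<ge> 2\<close> by auto
  qed
qed

section \<open>Elementary matrices and invertibility of the linear action\<close>

lemma GL_I:
  assumes "\<And>i j. i \<in> {1..d} \<Longrightarrow> j \<in> {1..d} \<Longrightarrow> (\<Sum>k=1..d. g i k * h k j) = (if i = j then 1 else 0)"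
    and "\<And>i j. i \<in> {1..d} \<Longrightarrow> j \<in> {1..d} \<Longrightarrow> (\<Sum>k=1..d. h i k * g k j) = (if i = j then 1 else 0)"
  shows "g \<in> GL d"
  unfolding GL_def mem_Collect_eq by (rule exI[of _ h]) (use assms in simp)

text \<open>Columns are images of generators, so this matrix sends x_a to x_a + c x_b; its inverse
  has -c in place of c.\<close>

lemma transvection_in_GL:
  fixes c :: "'k::field_char_0"
  assumes "a \<in> {1..d}" "b \<in> {1..d}" "a \<noteq> b"
  shows "(\<lambda>i j. if i = j then 1 else if i = b \<and> j = a then c else 0) \<in> GL d"
proof -
  define t where "t c i j = (if i = j then 1 else if i = b \<and> j = a then c else 0)" for c :: 'k and i j
  have prod: "(\<Sum>k=1..d. t c i k * t (- c) k j) = (if i = j then 1 else 0)"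
    if ij: "i \<in> {1..d}" "j \<in> {1..d}" for c i j
  proof -
    \<comment> \<open>Row i of the left factor has its entry 1 at k = i and, only if i = b, a
      further entry c at k = a.\<close>
    have "(\<Sum>k=1..d. t c i k * t (- c) k j) = (\<Sum>k=1..d. (if k = i then t (- c) i j else 0) +
        (if k = a then (if i = b then c * t (- c) a j else 0) else 0))"
      using assms(3) by (intro sum.cong) (auto simp: t_def)
    also have "\<dots> = t (- c) i j + (if i = b then c * t (- c) a j else 0)"
      using ij assms by (simp add: sum.distrib)
    also have "\<dots> = (if i = j then 1 else 0)"
      using assms(3) by (auto simp: t_def)
    finally show ?thesis .
  qed
  have "t c \<in> GL d"
    using prod[of _ _ c] prod[of _ _ "- c"] by (intro GL_I[of d "t c" "t (- c)"]) simp_all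
  then show ?thesis
    unfolding t_def .
qed

lemma transpose_in_GL:
  assumes "a \<in> {1..d}" "b \<in> {1..d}"
  shows "(\<lambda>i j. if i = Transposition.transpose a b j then 1 else 0 :: 'k::field_char_0) \<in> GL d"
proof -
  let ?t = "Transposition.transpose a b"
  have t: "?t j \<in> {1..d}" if "j \<in> {1..d}" for j
    using assms that by (auto simp: Transposition.transpose_def)
  have delta: "(\<Sum>k=1..d. (if i = ?t k then 1 else 0) * (if k = ?t j then 1 else 0)) = (if i = j then 1 else 0 :: 'k)"
    if "j \<in> {1..d}" for i j
  proof -
    have "(\<Sum>k=1..d. (if i = ?t k then 1 else 0) * (if k = ?t j then 1 else 0)) =
        (\<Sum>k=1..d. if k = ?t j then (if i = ?t k then 1 else 0 :: 'k) else 0)"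
      by (intro sum.cong) auto
    also have "\<dots> = (if i = j then 1 else 0)"
      using t[OF that] by simp
    finally show ?thesis .
  qed
  show ?thesis
    by (rule GL_I[where h = "\<lambda>i j. if i = ?t j then 1 else 0"]; rule delta)
qed

lemma mon_subst_yv: "mon_subst yv a = (Poly_Mapping.single (a, 0) 1 :: 'k::field_char_0 yz_poly)"
proof (induction "mdeg a" arbitrary: a)
  case 0
  then have "a = 0"
    using mdeg_pos_iff[of a] by auto
  then show ?case by (simp flip: zero_prod_def)
next
  case (Suc n)
  from Suc.hyps(2)[symmetric] obtain i a' where a': "a = Poly_Mapping.single i 1 + a'" "mdeg a' = n"
    by (rule mdeg_Suc_decompose)
  with Suc.hyps(1)[of a'] show ?case
    by (simp add: mon_subst_add mon_subst_single_one del: One_nat_def) (simp add: yv_def mult_single)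
qed

lemma mon_subst_zv: "mon_subst zv b = (Poly_Mapping.single (0, b) 1 :: 'k::field_char_0 yz_poly)"
proof (induction "mdeg b" arbitrary: b)
  case 0
  then have "b = 0"
    using mdeg_pos_iff[of b] by auto
  then show ?case by (simp flip: zero_prod_def)
next
  case (Suc n)
  from Suc.hyps(2)[symmetric] obtain i b' where b': "b = Poly_Mapping.single i 1 + b'" "mdeg b' = n"
    by (rule mdeg_Suc_decompose)
  with Suc.hyps(1)[of b'] show ?case
    by (simp add: mon_subst_add mon_subst_single_one del: One_nat_def) (simp add: zv_def mult_single)
qed

lemma psubst_id: "psubst yv zv p = p"
  unfolding psubst_alt mon_subst_yv mon_subst_zv
  by (subst (3) poly_mapping_sum_single) (simp add: Const_def mult_single mult.assoc)

lemma psubst_mon_subst: "psubst u v (mon_subst w a) = mon_subst (\<lambda>i. psubst u v (w i)) a"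
proof -
  have "psubst u v (\<Prod>i\<in>A. f i) = (\<Prod>i\<in>A. psubst u v (f i))" for f and A :: "nat set"
    using psubst_Const[of u v 1]
    by (induction A rule: infinite_finite_induct) (simp_all add: psubst_mult Const_simps)
  then show ?thesis
    by (simp add: mon_subst_def psubst_power)
qed

lemma psubst_psubst:
  "psubst u v (psubst u' v' p) = psubst (\<lambda>i. psubst u v (u' i)) (\<lambda>i. psubst u v (v' i)) p"
  by (simp add: psubst_alt[of u' v'] psubst_alt[of "\<lambda>i. psubst u v (u' i)"] psubst_sum psubst_mult
      psubst_Const psubst_mon_subst)

text \<open>For inverse matrices the composed substitution is the identity only at indices up to
  \<open>d\<close>; elements of the carrier contain no others.\<close>

lemma psubst_cong:
  assumes "p \<in> monomials_in d s t" "\<And>i. i \<in> {1..d} \<Longrightarrow> u i = u' i" "\<And>i. i \<in> {1..d} \<Longrightarrow> v i = v' i"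
  shows "psubst u v p = psubst u' v' p"
proof -
  have "mon_subst u (fst m) * mon_subst v (snd m) = mon_subst u' (fst m) * mon_subst v' (snd m)"
    if "m \<in> Poly_Mapping.keys p" for m
  proof -
    have "Poly_Mapping.keys (fst m) \<subseteq> {1..d}" "Poly_Mapping.keys (snd m) \<subseteq> {1..d}"
      using assms(1) that by (auto simp: monomials_in_def split_def)
    then show ?thesis
      unfolding mon_subst_def by (intro arg_cong2[of _ _ _ _ "(*)"] prod.cong) (use assms(2,3) in auto)
  qed
  then show ?thesis
    by (simp add: psubst_alt mult.assoc)
qed

lemma gl_act_pol:
  "gl_act d g (pol p) =
     pol (psubst (\<lambda>j. \<Sum>i=1..d. Const (g i j) * yv i) (\<lambda>j. \<Sum>i=1..d. Const (g i j) * zv i) p)"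
  by (simp add: gl_act_def pol_def)

lemma gl_act_sum: "gl_act d g (\<Sum>i\<in>A. f i) = (\<Sum>i\<in>A. gl_act d g (f i))"
proof -
  have "gl_act d g 0 = 0"
    using gl_act_scale[of d g 0 0] by simp
  then show ?thesis
    by (induction A rule: infinite_finite_induct) (simp_all add: gl_act_add)
qed

lemma galg_decompose:
  "f = (\<Sum>j\<in>Poly_Mapping.keys (fst f). gscale (Poly_Mapping.lookup (fst f) j) (gen j)) + pol (snd f)"
proof -
  have "(\<Sum>j\<in>A. gscale (c j) (gen j)) = (\<Sum>j\<in>A. Poly_Mapping.single j (c j), 0)"
    for c :: "nat \<Rightarrow> 'a" and A
    by (induction A rule: infinite_finite_induct)
       (auto simp: gscale_def gen_def zero_prod_def map_eq_zero_iff)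
  then show ?thesis
    by (simp add: pol_def prod_eq_iff flip: poly_mapping_sum_single)
qed

lemma Const_sum: "Const (\<Sum>i\<in>A. f i) = (\<Sum>i\<in>A. Const (f i))"
  by (induction A rule: infinite_finite_induct) (simp_all add: Const_simps)

text \<open>The composite fixes x_j, y_j and z_j for j up to \<open>d\<close>, hence every element
  of the carrier. It is used to show that a matrix maps a coset onto a coset and not merely into
  one.\<close>

lemma gl_act_inverse:
  fixes f :: "'k::field_char_0 galg"
  assumes gh: "\<And>i j. i \<in> {1..d} \<Longrightarrow> j \<in> {1..d} \<Longrightarrow> (\<Sum>k=1..d. g i k * h k j) = (if i = j then 1 else 0)"
    and f: "f \<in> G_carrier d"
  shows "gl_act d g (gl_act d h f) = f"
proof -
  \<comment> \<open>The scalar multiplication \<open>S\<close> is kept abstract: the same matrix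
    computation serves for \<open>gscale\<close> on the generators and for multiplication by
    \<open>Const\<close> on the y and the z.\<close>
  have comb: "(\<Sum>k=1..d. S (h k j) (\<Sum>i=1..d. S (g i k) (x i))) = x j"
    if j: "j \<in> {1..d}" and S: "\<And>c e y. S c (S e y) = S (c * e) y" "\<And>c f. S c (\<Sum>i=1..d. f i) = (\<Sum>i=1..d. S c (f i))"
      "\<And>c y. S (\<Sum>i=1..d. c i) y = (\<Sum>i=1..d. S (c i) y)" "\<And>y. S 0 y = 0" "\<And>y. S 1 y = y"
    for j and S :: "'k \<Rightarrow> 'b \<Rightarrow> 'b::comm_monoid_add" and x
  proof -
    have "(\<Sum>k=1..d. S (h k j) (\<Sum>i=1..d. S (g i k) (x i))) = (\<Sum>i=1..d. \<Sum>k=1..d. S (g i k * h k j) (x i))"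
      unfolding S by (subst sum.swap) (simp add: mult.commute)
    also have "\<dots> = (\<Sum>i=1..d. S (if i = j then 1 else 0) (x i))"
      unfolding S(3)[symmetric] using gh[OF _ j] by (intro sum.cong) simp_all
    also have "\<dots> = (\<Sum>i=1..d. if i = j then x i else 0)"
      by (intro sum.cong) (auto simp: S)
    finally show ?thesis
      using j by simp
  qed
  have 1: "gl_act d g (gl_act d h (gen j)) = gen j" if "j \<in> {1..d}" for j
  proof -
    have "gscale (\<Sum>i=1..d. c i) y = (\<Sum>i=1..d. gscale (c i) y)" for c and y :: "'k galg"
      by (induction d) (simp_all add: gscale_add_left)
    then show ?thesis
      using comb[OF that, of gscale gen]
      by (simp add: gl_act_gen gl_act_sum gl_act_scale gscale_gscale gscale_sum)
  qed
  have 2: "gl_act d g (gl_act d h (pol (snd f))) = pol (snd f)"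
  proof -
    let ?u = "\<lambda>j. \<Sum>i=1..d. Const (g i j) * yv i" and ?v = "\<lambda>j. \<Sum>i=1..d. Const (g i j) * zv i"
    let ?u' = "\<lambda>j. \<Sum>i=1..d. Const (h i j) * yv i" and ?v' = "\<lambda>j. \<Sum>i=1..d. Const (h i j) * zv i"
    have "psubst ?u ?v (?u' j) = yv j" "psubst ?u ?v (?v' j) = zv j" if "j \<in> {1..d}" for j
      unfolding psubst_sum psubst_mult psubst_Const psubst_yv psubst_zv
      by (rule comb[OF that]; simp add: Const_simps Const_sum sum_distrib_left sum_distrib_right mult.assoc)+
    then have "psubst ?u ?v (psubst ?u' ?v' (snd f)) = psubst yv zv (snd f)"
      unfolding psubst_psubst using f by (intro psubst_cong[where d = d]) (auto simp: G_carrier_iff)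
    then show ?thesis
      by (simp add: gl_act_pol psubst_id)
  qed
  have "gl_act d g (gl_act d h f) = (\<Sum>j\<in>Poly_Mapping.keys (fst f).
      gscale (Poly_Mapping.lookup (fst f) j) (gl_act d g (gl_act d h (gen j)))) + pol (snd f)"
    by (subst galg_decompose[of f]) (simp add: gl_act_add gl_act_sum gl_act_scale 2)
  also have "\<dots> = (\<Sum>j\<in>Poly_Mapping.keys (fst f). gscale (Poly_Mapping.lookup (fst f) j) (gen j)) + pol (snd f)"
    using f by (intro arg_cong2[of _ _ _ _ "(+)"] sum.cong) (auto simp: 1 G_carrier_iff subset_iff)
  also have "\<dots> = f"
    by (rule galg_decompose[symmetric])
  finally show ?thesis .
qed

lemma gl_act_G_comp:
  assumes "f \<in> G_comp d n"
  shows "gl_act d g f \<in> G_comp d n"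
proof -
  let ?u = "\<lambda>j. \<Sum>i=1..d. Const (g i j) * yv i" and ?v = "\<lambda>j. \<Sum>i=1..d. Const (g i j) * zv i"
  have "?u j \<in> homogeneous 1" "?v j \<in> homogeneous 1" for j
    using homogeneous_mult[OF homogeneous_Const homogeneous_yv]
      homogeneous_mult[OF homogeneous_Const homogeneous_zv]
    by (auto intro!: homogeneous_sum)
  then have "snd (gl_act d g f) \<in> homogeneous n"
    using assms by (auto simp: gl_act_def G_comp_iff intro!: homogeneous_psubst)
  moreover have "fst (gl_act d g f) = 0" if "fst f = 0"
    using that by (simp add: gl_act_def)
  ultimately show ?thesis
    using assms gl_act_closed[of f d g] by (auto simp: G_comp_iff)
qed

text \<open>The action on polynomials is a substitution \<open>psubst u v\<close>. Only its values
  at indices up to \<open>d\<close> are controlled, so \<open>u\<close> and \<open>v\<close> are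
  obtained instead of being prescribed everywhere.\<close>

lemma stable_transpose:
  fixes M :: "'k::field_char_0 galg set"
  assumes "\<And>g f. g \<in> GL d \<Longrightarrow> f \<in> M \<Longrightarrow> gl_act d g f \<in> M" "a \<in> {1..d}" "b \<in> {1..d}"
  obtains u v where "\<And>p. pol p \<in> M \<Longrightarrow> pol (psubst u v p) \<in> M"
    "\<And>j. j \<in> {1..d} \<Longrightarrow> u j = yv (Transposition.transpose a b j)"
    "\<And>j. j \<in> {1..d} \<Longrightarrow> v j = zv (Transposition.transpose a b j)"
proof -
  define g where "g = (\<lambda>i j. if i = Transposition.transpose a b j then 1 else 0 :: 'k)"
  have "(\<Sum>i=1..d. Const (g i j) * x i) = x (Transposition.transpose a b j)"
    if "j \<in> {1..d}" for x :: "nat \<Rightarrow> 'k yz_poly" and j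
  proof -
    have "(\<Sum>i=1..d. Const (g i j) * x i) = (\<Sum>i=1..d. if i = Transposition.transpose a b j then x i else 0)"
      by (intro sum.cong) (auto simp: g_def Const_simps)
    moreover have "Transposition.transpose a b j \<in> {1..d}"
      using that assms(2,3) by (auto simp: Transposition.transpose_def)
    ultimately show ?thesis by simp
  qed
  with that[OF assms(1)[of g "pol _", unfolded gl_act_pol]] transpose_in_GL[OF assms(2,3), where 'k = 'k]
  show thesis
    unfolding g_def by blast
qed

lemma stable_transvection:
  fixes M :: "'k::field_char_0 galg set"
  assumes "\<And>g f. g \<in> GL d \<Longrightarrow> f \<in> M \<Longrightarrow> gl_act d g f \<in> M" "a \<in> {1..d}" "b \<in> {1..d}" "a \<noteq> b"
  shows "\<exists>u v. (\<forall>p. pol p \<in> M \<longrightarrow> pol (psubst u v p) \<in> M) \<and>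
    u a = yv a + Const c * yv b \<and> v a = zv a + Const c * zv b \<and>
    (\<forall>j\<in>{1..d} - {a}. u j = yv j \<and> v j = zv j)"
proof -
  define g where "g = (\<lambda>i j. if i = j then 1 else if i = b \<and> j = a then c else 0)"
  have act: "(\<Sum>i=1..d. Const (g i j) * x i) = (if j = a then x a + Const c * x b else x j)"
    if "j \<in> {1..d}" for x :: "nat \<Rightarrow> 'k yz_poly" and j
  proof -
    have "(\<Sum>i=1..d. Const (g i j) * x i) = (\<Sum>i=1..d. (if i = j then x i else 0) +
        (if i = b then (if j = a then Const c * x b else 0) else 0))"
      using assms(4) by (intro sum.cong) (auto simp: g_def Const_simps)
    then show ?thesis
      using that assms(3) by (simp add: sum.distrib)
  qed
  have g: "g \<in> GL d"
    unfolding g_def by (rule transvection_in_GL[OF assms(2-4)])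
  show ?thesis
    by (rule exI[of _ "\<lambda>j. \<Sum>i=1..d. Const (g i j) * yv i"],
        rule exI[of _ "\<lambda>j. \<Sum>i=1..d. Const (g i j) * zv i"])
       (use act g assms(1)[of g "pol _", unfolded gl_act_pol] assms(2) in simp)
qed

text \<open>Highest weight vectors involve only the indices 1 and 2, so it is enough to carry this
  pair to any pair of distinct indices. Two transpositions do it: the first brings 1 to i, the
  second brings the image of 2 to j without moving i.\<close>

lemma GL_stable_move:
  fixes M :: "'k::field_char_0 galg set"
  assumes "d \<ge> 2" and M: "\<And>g f. g \<in> GL d \<Longrightarrow> f \<in> M \<Longrightarrow> gl_act d g f \<in> M"
    and ij: "i \<in> {1..d}" "j \<in> {1..d}" "i \<noteq> j"
  shows "\<exists>u v. (\<forall>p. pol p \<in> M \<longrightarrow> pol (psubst u v p) \<in> M) \<and>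
    u 1 = yv i \<and> u 2 = yv j \<and> v 1 = zv i \<and> v 2 = zv j"
proof -
  \<comment> \<open>The place to which the first transposition sends 2: it is 1 if i = 2, and 2
    otherwise.\<close>
  define k where "k = Transposition.transpose 1 i 2"
  have k: "k \<in> {1..d}" "k \<noteq> i"
    using assms(1) ij by (auto simp: k_def Transposition.transpose_def)
  have 12: "1 \<in> {1..d}" "2 \<in> {1..d}"
    using assms(1) by auto
  obtain u v where uv: "\<And>p. pol p \<in> M \<Longrightarrow> pol (psubst u v p) \<in> M"
    "\<And>l. l \<in> {1..d} \<Longrightarrow> u l = yv (Transposition.transpose 1 i l)"
    "\<And>l. l \<in> {1..d} \<Longrightarrow> v l = zv (Transposition.transpose 1 i l)"
    using stable_transpose[OF M 12(1) ij(1)] by blast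
  obtain u' v' where uv': "\<And>p. pol p \<in> M \<Longrightarrow> pol (psubst u' v' p) \<in> M"
    "\<And>l. l \<in> {1..d} \<Longrightarrow> u' l = yv (Transposition.transpose k j l)"
    "\<And>l. l \<in> {1..d} \<Longrightarrow> v' l = zv (Transposition.transpose k j l)"
    using stable_transpose[OF M k(1) ij(2)] by blast
  have uv_eq: "u 1 = yv i" "u 2 = yv k" "v 1 = zv i" "v 2 = zv k"
    using uv(2,3)[OF 12(1)] uv(2,3)[OF 12(2)] by (simp_all add: k_def)
  have uv'_eq: "u' i = yv i" "u' k = yv j" "v' i = zv i" "v' k = zv j"
    using uv'(2,3)[OF ij(1)] uv'(2,3)[OF k(1)] ij(3) k(2) by (simp_all add: Transposition.transpose_def)
  have closed: "pol (psubst (\<lambda>i. psubst u' v' (u i)) (\<lambda>i. psubst u' v' (v i)) p) \<in> M" if "pol p \<in> M" for p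
    using uv'(1)[OF uv(1)[OF that]] by (simp add: psubst_psubst)
  show ?thesis
    by (rule exI[of _ "\<lambda>i. psubst u' v' (u i)"], rule exI[of _ "\<lambda>i. psubst u' v' (v i)"])
       (use closed uv_eq in \<open>simp add: psubst_yv psubst_zv uv'_eq\<close>)
qed

section \<open>Stable subspaces generated by highest weight vectors\<close>

lemma GL_stable_degree_2:
  fixes M :: "'k::field_char_0 galg set"
  assumes "d \<ge> 2" and S: "subspace_of (G d) M"
    and M: "\<And>g f. g \<in> GL d \<Longrightarrow> f \<in> M \<Longrightarrow> gl_act d g f \<in> M"
    and w: "pol (yv 1 * zv 1) \<in> M" "pol (yv 1 * zv 2 - yv 2 * zv 1) \<in> M"
  shows "G_comp d 2 \<subseteq> M"
proof (rule G_comp_2_subset[OF S])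
  interpret yz_subspace "{p. pol p \<in> M}"
    by (rule yz_subspace_pol[OF S])
  have sq: "yv i * zv i \<in> {p. pol p \<in> M}" if i: "i \<in> {1..d}" for i
  proof -
    obtain j where j: "j \<in> {1..d}" "i \<noteq> j"
      using \<open>d \<ge> 2\<close> that[of 1] that[of 2] by (cases "i = 1") auto
    obtain u v where uv: "\<And>p. pol p \<in> M \<Longrightarrow> pol (psubst u v p) \<in> M"
      "u 1 = yv i" "u 2 = yv j" "v 1 = zv i" "v 2 = zv j"
      using GL_stable_move[OF assms(1) M i j] by blast
    show ?thesis
      using uv(1)[OF w(1)] by (simp only: psubst_simps uv(2,4) mem_Collect_eq)
  qed
  fix i j assume ij: "{i, j} \<subseteq> {1..d}"
  show "pol (yv i * zv j) \<in> M"
  proof (cases "i = j")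
    case True
    then show ?thesis using sq ij by auto
  next
    case False
    have ij': "i \<in> {1..d}" "j \<in> {1..d}"
      using ij by auto
    obtain u v where uv: "\<And>p. pol p \<in> M \<Longrightarrow> pol (psubst u v p) \<in> M"
      "u 1 = yv i" "u 2 = yv j" "v 1 = zv i" "v 2 = zv j"
      using GL_stable_move[OF assms(1) M ij' False] by blast
    have skew: "yv i * zv j - yv j * zv i \<in> {p. pol p \<in> M}"
      using uv(1)[OF w(2)] by (simp only: psubst_simps uv(2-) mem_Collect_eq)
    obtain u v where uv: "\<And>p. pol p \<in> M \<Longrightarrow> pol (psubst u v p) \<in> M"
      "u i = yv i + Const 1 * yv j" "v i = zv i + Const 1 * zv j"
      using stable_transvection[OF M ij' False] by blast
    have sum: "(yv i + yv j) * (zv i + zv j) \<in> {p. pol p \<in> M}"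
      using uv(1)[of "yv i * zv i"] sq[OF ij'(1)] by (simp add: psubst_simps Const_simps uv(2,3))
    \<comment> \<open>The transvection polarizes the square to the symmetric part of y_i z_j, and
      the moved highest weight vector supplies the skew part.\<close>
    have "2 * (yv i * zv j) = (yv i + yv j) * (zv i + zv j) - yv i * zv i - yv j * zv j +
        (yv i * zv j - yv j * zv i :: 'k yz_poly)"
      by (simp add: algebra_simps)
    also have "\<dots> \<in> {p. pol p \<in> M}"
      using ij by (intro closed sum skew sq) auto
    finally show ?thesis
      using cancel_numeral by blast
  qed
qed

text \<open>The action treats the y and the z alike, so one argument with \<open>Y\<close> and
  \<open>Z\<close> in either role serves both bidegrees (2,1) and (1,2).\<close>

lemma GL_stable_cubic_monomials:
  fixes M :: "'k::field_char_0 galg set"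
  assumes "d \<ge> 2" and S: "subspace_of (G d) M"
    and M: "\<And>g f. g \<in> GL d \<Longrightarrow> f \<in> M \<Longrightarrow> gl_act d g f \<in> M"
    and YZ: "Y = yv \<and> Z = zv \<or> Y = zv \<and> Z = yv"
    and w: "pol (Y 1 * Y 1 * Z 1) \<in> M" "pol (Y 1 * (Y 1 * Z 2 - Y 2 * Z 1)) \<in> M"
    and ijk: "{i, j, k} \<subseteq> {1..d}"
  shows "pol (Y i * Y j * Z k) \<in> M"
proof -
  interpret yz_subspace "{p. pol p \<in> M}"
    by (rule yz_subspace_pol[OF S])
  have move: "\<exists>u v. (\<forall>p. pol p \<in> M \<longrightarrow> pol (psubst u v p) \<in> M) \<and> psubst u v (Y 1) = Y i \<and>
      psubst u v (Y 2) = Y j \<and> psubst u v (Z 1) = Z i \<and> psubst u v (Z 2) = Z j"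
    if ij: "i \<in> {1..d}" "j \<in> {1..d}" "i \<noteq> j" for i j
  proof -
    obtain u v where "\<And>p. pol p \<in> M \<Longrightarrow> pol (psubst u v p) \<in> M"
      "u 1 = yv i" "u 2 = yv j" "v 1 = zv i" "v 2 = zv j"
      using GL_stable_move[OF assms(1) M ij] by blast
    note uv = this
    show ?thesis
      by (rule exI[of _ u], rule exI[of _ v], rule disjE[OF YZ])
         (use uv in \<open>simp_all add: psubst_yv psubst_zv\<close>)
  qed
  have tv: "\<exists>u v. (\<forall>p. pol p \<in> M \<longrightarrow> pol (psubst u v p) \<in> M) \<and>
      psubst u v (Y i) = Y i + Const c * Y j \<and> psubst u v (Z i) = Z i + Const c * Z j \<and>
      (\<forall>l\<in>{1..d} - {i}. psubst u v (Y l) = Y l \<and> psubst u v (Z l) = Z l)"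
    if ij: "i \<in> {1..d}" "j \<in> {1..d}" "i \<noteq> j" for i j c
  proof -
    obtain u v where "\<And>p. pol p \<in> M \<Longrightarrow> pol (psubst u v p) \<in> M"
      "u i = yv i + Const c * yv j" "v i = zv i + Const c * zv j"
      "\<forall>l\<in>{1..d} - {i}. u l = yv l \<and> v l = zv l"
      using stable_transvection[OF M ij] by blast
    note uv = this
    show ?thesis
      by (rule exI[of _ u], rule exI[of _ v], rule disjE[OF YZ])
         (use uv in \<open>simp_all add: psubst_yv psubst_zv\<close>)
  qed
  have cube: "Y i * Y i * Z i \<in> {p. pol p \<in> M}" if i: "i \<in> {1..d}" for i
  proof -
    obtain j where "j \<in> {1..d}" "i \<noteq> j"
      using \<open>d \<ge> 2\<close> that[of 1] that[of 2] by (cases "i = 1") auto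
    from move[OF i this] obtain u v where uv: "\<And>p. pol p \<in> M \<Longrightarrow> pol (psubst u v p) \<in> M"
      "psubst u v (Y 1) = Y i" "psubst u v (Z 1) = Z i"
      by blast
    show ?thesis
      using uv(1)[OF w(1)] by (simp only: psubst_mult uv(2,3) mem_Collect_eq)
  qed
  have skew: "Y i * (Y i * Z j - Y j * Z i) \<in> {p. pol p \<in> M}" if ij: "{i, j} \<subseteq> {1..d}" "i \<noteq> j" for i j
  proof -
    obtain u v where uv: "\<And>p. pol p \<in> M \<Longrightarrow> pol (psubst u v p) \<in> M"
      "psubst u v (Y 1) = Y i" "psubst u v (Y 2) = Y j" "psubst u v (Z 1) = Z i" "psubst u v (Z 2) = Z j"
      using move[of i j] ij by blast
    show ?thesis
      using uv(1)[OF w(2)] by (simp only: psubst_mult psubst_diff uv(2-) mem_Collect_eq)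
  qed
  \<comment> \<open>The transvection by c applied to the cube of index i; the values c = 1 and c =
    -1 give \<open>sum\<close> and \<open>dif\<close>.\<close>
  have lin: "(Y i + Const c * Y j) * (Y i + Const c * Y j) * (Z i + Const c * Z j) \<in> {p. pol p \<in> M}"
    if ij: "{i, j} \<subseteq> {1..d}" "i \<noteq> j" for i j c
  proof -
    obtain u v where uv: "\<And>p. pol p \<in> M \<Longrightarrow> pol (psubst u v p) \<in> M"
      "psubst u v (Y i) = Y i + Const c * Y j" "psubst u v (Z i) = Z i + Const c * Z j"
      using tv[of i j c] ij by blast
    show ?thesis
      using uv(1)[of "Y i * Y i * Z i"] cube[of i] ij by (simp add: psubst_mult uv(2,3))
  qed
  have sum: "(Y i + Y j) * (Y i + Y j) * (Z i + Z j) \<in> {p. pol p \<in> M}"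
    and dif: "(Y i - Y j) * (Y i - Y j) * (Z i - Z j) \<in> {p. pol p \<in> M}"
    if "{i, j} \<subseteq> {1..d}" "i \<noteq> j" for i j
    using lin[OF that, of 1] lin[OF that, of "- 1"] by (simp_all add: Const_simps Const_minus)
  \<comment> \<open>Obtained from the skew relation for i, k by sending x_i to x_i + x_j, which
    leaves the index k alone.\<close>
  have skew_sum: "(Y i + Y j) * ((Y i + Y j) * Z k - Y k * (Z i + Z j)) \<in> {p. pol p \<in> M}"
    if ijk: "{i, j, k} \<subseteq> {1..d}" "distinct [i, j, k]" for i j k
  proof -
    have ijk': "i \<in> {1..d}" "j \<in> {1..d}" "k \<in> {1..d}" "i \<noteq> j" "i \<noteq> k" "j \<noteq> k"
      using ijk by auto
    obtain u v where uv: "\<And>p. pol p \<in> M \<Longrightarrow> pol (psubst u v p) \<in> M"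
      "psubst u v (Y i) = Y i + Const 1 * Y j" "psubst u v (Z i) = Z i + Const 1 * Z j"
      "\<forall>l\<in>{1..d} - {i}. psubst u v (Y l) = Y l \<and> psubst u v (Z l) = Z l"
      using tv[of i j 1, OF ijk'(1,2,4)] by blast
    have "psubst u v (Y k) = Y k" "psubst u v (Z k) = Z k"
      using uv(4) ijk' by blast+
    note uv = uv(1-3) this
    show ?thesis
      using uv(1)[of "Y i * (Y i * Z k - Y k * Z i)"] skew[of i k] ijk
      by (simp add: psubst_mult psubst_diff uv(2-) Const_simps)
  qed
  \<comment> \<open>Obtained from the cube of the sum over i, j by sending x_j to x_j + x_k.\<close>
  have sym_sum: "(Y i + Y j + Y k) * (Y i + Y j + Y k) * (Z i + Z j + Z k) \<in> {p. pol p \<in> M}"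
    if ijk: "{i, j, k} \<subseteq> {1..d}" "distinct [i, j, k]" for i j k
  proof -
    have ijk': "i \<in> {1..d}" "j \<in> {1..d}" "k \<in> {1..d}" "i \<noteq> j" "i \<noteq> k" "j \<noteq> k"
      using ijk by auto
    obtain u v where uv: "\<And>p. pol p \<in> M \<Longrightarrow> pol (psubst u v p) \<in> M"
      "psubst u v (Y j) = Y j + Const 1 * Y k" "psubst u v (Z j) = Z j + Const 1 * Z k"
      "\<forall>l\<in>{1..d} - {j}. psubst u v (Y l) = Y l \<and> psubst u v (Z l) = Z l"
      using tv[of j k 1, OF ijk'(2,3,6)] by blast
    have "psubst u v (Y i) = Y i" "psubst u v (Z i) = Z i"
      using uv(4) ijk' by blast+
    note uv = uv(1-3) this
    show ?thesis
      using uv(1)[of "(Y i + Y j) * (Y i + Y j) * (Z i + Z j)"] sum[of i j] ijk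
      by (simp add: psubst_mult psubst_add uv(2-) Const_simps add.assoc)
  qed
  have "Y i * Y j * Z k \<in> {p. pol p \<in> M}"
    by (rule cubic_monomials_of_highest_weight[OF cube sum dif skew skew_sum sym_sum ijk])
  then show ?thesis by simp
qed

text \<open>The list has one vector of weight (3) only, namely y_1^2 z_1. Its partner y_1 z_1^2
  comes from the defining identity, since alpha_2 \<noteq> 0; with it, the bidegrees (2,1) and (1,2)
  are treated alike.\<close>

lemma GL_stable_degree_3:
  fixes M :: "'k::field_char_0 galg set"
  assumes "d \<ge> 2" and S: "subspace_of (G d) M"
    and M: "\<And>g f. g \<in> GL d \<Longrightarrow> f \<in> M \<Longrightarrow> gl_act d g f \<in> M"
    and U: "U_ideal d \<alpha>\<^sub>1 \<alpha>\<^sub>2 \<subseteq> M" and "\<alpha>\<^sub>2 \<noteq> 0"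
    and w: "pol (yv 1 * yv 1 * zv 1) \<in> M" "pol (yv 1 * (yv 1 * zv 2 - yv 2 * zv 1)) \<in> M"
      "pol ((yv 1 * zv 2 - yv 2 * zv 1) * zv 1) \<in> M"
  shows "G_comp d 3 \<subseteq> M"
proof -
  interpret yz_subspace "{p. pol p \<in> M}"
    by (rule yz_subspace_pol[OF S])
  have "Const \<alpha>\<^sub>1 * (yv 1)\<^sup>2 * zv 1 + Const \<alpha>\<^sub>2 * yv 1 * (zv 1)\<^sup>2 \<in> {p. pol p \<in> M}"
    using U_ideal_identity[of d "gen 1" \<alpha>\<^sub>1 \<alpha>\<^sub>2] \<open>d \<ge> 2\<close> U by auto
  then have "Const \<alpha>\<^sub>1 * (yv 1)\<^sup>2 * zv 1 + Const \<alpha>\<^sub>2 * yv 1 * (zv 1)\<^sup>2 -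
      Const \<alpha>\<^sub>1 * (yv 1 * yv 1 * zv 1) \<in> {p. pol p \<in> M}"
    using w(1) by (intro diff smult) auto
  then have "Const \<alpha>\<^sub>2 * (zv 1 * zv 1 * yv 1) \<in> {p. pol p \<in> M}"
    by (simp add: power2_eq_square algebra_simps)
  then have w0: "pol (zv 1 * zv 1 * yv 1) \<in> M"
    using cancel \<open>\<alpha>\<^sub>2 \<noteq> 0\<close> by blast
  \<comment> \<open>Up to sign this is the third listed vector, rewritten so that z plays the role
    of \<open>Y\<close>.\<close>
  have w1: "pol (zv 1 * (zv 1 * yv 2 - zv 2 * yv 1)) \<in> M"
    using uminus[of "(yv 1 * zv 2 - yv 2 * zv 1) * zv 1"] w(3) by (simp add: algebra_simps)
  have "pol (yv i * yv j * zv k) \<in> M" "pol (zv j * zv k * yv i) \<in> M" if "{i, j, k} \<subseteq> {1..d}" for i j k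
    using GL_stable_cubic_monomials[OF assms(1) S M _ w(1,2), of i j k]
      GL_stable_cubic_monomials[OF assms(1) S M _ w0 w1, of j k i] that by auto
  then show ?thesis
    by (intro G_comp_3_subset[OF S]) (auto simp: mult_ac)
qed

section \<open>The factor algebra modulo a T-ideal\<close>

lemma UN_constant_on:
  "X \<noteq> {} \<Longrightarrow> (\<And>x. x \<in> X \<Longrightarrow> F x = K) \<Longrightarrow> (\<Union>x\<in>X. F x) = K"
  by blast

locale T_ideal_factor =
  fixes d :: nat and I :: "'k::field_char_0 galg set"
  assumes I: "T_ideal (G d) I"
begin

abbreviation cs :: "'k galg \<Rightarrow> 'k galg set" where
  "cs \<equiv> coset (G d) I"

abbreviation Q :: "('k, 'k galg set) nonassoc_algebra" where
  "Q \<equiv> factor_algebra (G d) I"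

lemma mem_cs: "x \<in> cs f \<longleftrightarrow> x - f \<in> I"
  by (auto simp: coset_def G_def image_iff algebra_simps intro!: bexI[of _ "x - f"])

lemmas I_subspace = T_ideal_G_D(1)[OF I]
lemmas I_closed = subspace_G_D[OF I_subspace]

lemma I_diff: "f \<in> I \<Longrightarrow> g \<in> I \<Longrightarrow> f - g \<in> I"
  using I_closed(2)[of f "- g"] subspace_G_uminus[OF I_subspace, of g] by simp

lemma cs_eqI:
  assumes "f - g \<in> I"
  shows "cs f = cs g"
proof -
  have "x - f \<in> I \<longleftrightarrow> x - g \<in> I" for x
    using I_closed(2)[of "x - f" "f - g"] I_diff[of "x - g" "f - g"] assms by auto
  then show ?thesis
    by (auto simp: mem_cs)
qed

lemma self_in_cs: "f \<in> cs f"
  using I_closed(1) by (simp add: mem_cs)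

lemma cs_eq_I: "f \<in> I \<Longrightarrow> cs f = I"
  using cs_eqI[of f 0] by (metis diff_zero mem_cs set_eqI)

lemma cs_nonempty: "cs f \<noteq> {}"
  using self_in_cs[of f] by (metis empty_iff)

lemma carrier_Q: "carrier Q = cs ` G_carrier d"
  and zero_Q: "zero Q = I"
  by (simp_all add: factor_algebra_def G_def)

text \<open>The operations of the factor algebra are unions over all representatives, so they are
  well defined exactly because the united family is constant; the other operations are handled in
  the same way.\<close>

lemma add_Q: "add Q (cs f) (cs g) = cs (f + g)"
proof -
  have "cs (x + y) = cs (f + g)" if "x \<in> cs f" "y \<in> cs g" for x y
    using that I_closed(2)[of "x - f" "y - g"] by (intro cs_eqI) (simp add: mem_cs algebra_simps)
  then have "(\<Union>x\<in>cs f. \<Union>y\<in>cs g. cs (x + y)) = cs (f + g)"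
    by (intro UN_constant_on cs_nonempty)
  then show ?thesis
    by (simp add: factor_algebra_def G_def)
qed

lemma scale_Q: "scale Q c (cs f) = cs (gscale c f)"
proof -
  have "cs (gscale c x) = cs (gscale c f)" if "x \<in> cs f" for x
  proof (rule cs_eqI)
    have "gscale c x - gscale c f = gscale c (x - f)"
      using gscale_add_right[of c "x - f" f] by simp
    then show "gscale c x - gscale c f \<in> I"
      using that I_closed(3) by (simp add: mem_cs)
  qed
  then have "(\<Union>x\<in>cs f. cs (gscale c x)) = cs (gscale c f)"
    by (intro UN_constant_on cs_nonempty)
  then show ?thesis
    by (simp add: factor_algebra_def G_def)
qed

lemma cs_subset_carrier: "f \<in> G_carrier d \<Longrightarrow> x \<in> cs f \<Longrightarrow> x \<in> G_carrier d"
  using subspace_G_D(2)[OF subspace_G_carrier, of f d "x - f"] I_closed(4)[of "x - f"]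
  by (simp add: mem_cs)

text \<open>The difference xy - fg equals (x - f) y + f (y - g). The ideal absorbs products with
  elements of the carrier only, which is why the factors are required to lie there.\<close>

lemma mult_Q:
  assumes "f \<in> G_carrier d" "g \<in> G_carrier d"
  shows "mult Q (cs f) (cs g) = cs (gmul f g)"
proof -
  have "cs (gmul x y) = cs (gmul f g)" if xy: "x \<in> cs f" "y \<in> cs g" for x y
  proof (rule cs_eqI)
    have "gmul (x - f) y + gmul f (y - g) \<in> I"
      using xy assms(1) cs_subset_carrier[OF assms(2) xy(2)] unfolding mem_cs
      by (intro I_closed(2) T_ideal_G_D(2)[OF I, of "x - f"] T_ideal_G_D(3)[OF I, of "y - g"])
    moreover have "gmul x y = gmul (x - f) y + (gmul f (y - g) + gmul f g)"
      using gmul_bilinear(1)[of "x - f" f y] gmul_bilinear(2)[of f "y - g" g] by simp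
    ultimately show "gmul x y - gmul f g \<in> I"
      by (simp add: add.assoc[symmetric])
  qed
  then have "(\<Union>x\<in>cs f. \<Union>y\<in>cs g. cs (gmul x y)) = cs (gmul f g)"
    by (intro UN_constant_on cs_nonempty)
  then show ?thesis
    by (simp add: factor_algebra_def G_def)
qed

lemma pullback_subspace:
  assumes "subspace_of Q M"
  shows "subspace_of (G d) {f \<in> G_carrier d. cs f \<in> M}" "I \<subseteq> {f \<in> G_carrier d. cs f \<in> M}"
proof -
  have M: "I \<in> M" "\<And>X Y. X \<in> M \<Longrightarrow> Y \<in> M \<Longrightarrow> add Q X Y \<in> M" "\<And>c X. X \<in> M \<Longrightarrow> scale Q c X \<in> M"
    using assms unfolding subspace_of_def zero_Q by blast+
  show "I \<subseteq> {f \<in> G_carrier d. cs f \<in> M}"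
    using M(1) I_closed(4) cs_eq_I by auto
  show "subspace_of (G d) {f \<in> G_carrier d. cs f \<in> M}"
    unfolding subspace_G_iff
  proof (intro conjI ballI allI)
    show "0 \<in> {f \<in> G_carrier d. cs f \<in> M}"
      using M(1) I_closed(1,4) cs_eq_I[of 0] by simp
    show "f + g \<in> {f \<in> G_carrier d. cs f \<in> M}"
      if "f \<in> {f \<in> G_carrier d. cs f \<in> M}" "g \<in> {f \<in> G_carrier d. cs f \<in> M}" for f g
      using that M(2)[of "cs f" "cs g"] subspace_G_D(2)[OF subspace_G_carrier, of f d g] by (simp add: add_Q)
    show "gscale c f \<in> {f \<in> G_carrier d. cs f \<in> M}" if "f \<in> {f \<in> G_carrier d. cs f \<in> M}" for c f
      using that M(3)[of "cs f" c] subspace_G_D(3)[OF subspace_G_carrier, of f d c] by (simp add: scale_Q)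
  qed auto
qed

lemma image_subspace:
  assumes "subspace_of (G d) M"
  shows "subspace_of Q (cs ` M)"
  unfolding subspace_of_def carrier_Q zero_Q
proof (intro conjI ballI allI)
  note M = subspace_G_D[OF assms]
  show "cs ` M \<subseteq> cs ` G_carrier d"
    using M(4) by blast
  show "I \<in> cs ` M"
    using M(1) cs_eq_I[OF I_closed(1)] by blast
  show "add Q X Y \<in> cs ` M" if "X \<in> cs ` M" "Y \<in> cs ` M" for X Y
  proof -
    obtain f g where "f \<in> M" "g \<in> M" "X = cs f" "Y = cs g" using \<open>X \<in> _\<close> \<open>Y \<in> _\<close> by blast
    with M(2) show ?thesis by (simp add: add_Q)
  qed
  show "scale Q c X \<in> cs ` M" if "X \<in> cs ` M" for c X
  proof -
    obtain f where "f \<in> M" "X = cs f" using \<open>X \<in> _\<close> by blast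
    with M(3) show ?thesis by (simp add: scale_Q)
  qed
qed

text \<open>A T-ideal is mapped into itself, so the endomorphism descends to cosets; the induced map
  is again written as a union over representatives.\<close>

lemma factor_endomorphism:
  assumes \<phi>: "endomorphism_of (G d) \<phi>"
  shows "\<exists>\<psi>. endomorphism_of Q \<psi> \<and> (\<forall>f\<in>G_carrier d. \<psi> (cs f) = cs (\<phi> f))"
proof -
  have \<phi>': "\<And>f. f \<in> G_carrier d \<Longrightarrow> \<phi> f \<in> G_carrier d"
    "\<And>f g. f \<in> G_carrier d \<Longrightarrow> g \<in> G_carrier d \<Longrightarrow> \<phi> (f + g) = \<phi> f + \<phi> g"
    "\<And>c f. f \<in> G_carrier d \<Longrightarrow> \<phi> (gscale c f) = gscale c (\<phi> f)"
    "\<And>f g. f \<in> G_carrier d \<Longrightarrow> g \<in> G_carrier d \<Longrightarrow> \<phi> (gmul f g) = gmul (\<phi> f) (\<phi> g)"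
    using \<phi> unfolding endomorphism_of_def G_def by simp_all
  define \<psi> where "\<psi> X = (\<Union>x\<in>X. cs (\<phi> x))" for X
  have eq: "\<psi> (cs f) = cs (\<phi> f)" if f: "f \<in> G_carrier d" for f
    unfolding \<psi>_def
  proof (rule UN_constant_on)
    show "cs f \<noteq> {}"
      by (rule cs_nonempty)
    fix x assume "x \<in> cs f"
    then have x: "x - f \<in> I" "x - f \<in> G_carrier d"
      using I_closed(4) by (simp_all add: mem_cs)
    then have "\<phi> x - \<phi> f = \<phi> (x - f)"
      using \<phi>'(2)[OF x(2) f] by simp
    then show "cs (\<phi> x) = cs (\<phi> f)"
      using T_ideal_G_D(5)[OF I x(1) \<phi>] by (intro cs_eqI) simp
  qed
  note C = subspace_G_D[OF subspace_G_carrier]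
  have "endomorphism_of Q \<psi>"
    unfolding endomorphism_of_def carrier_Q
    by (simp add: add_Q scale_Q mult_Q eq \<phi>' C gmul_closed)
  with eq show ?thesis by metis
qed

text \<open>Invariance holds because each endomorphism of \<open>G d\<close> induces one of the
  factor algebra, under which \<open>J\<close> is stable. This moves the degree computations from
  cosets to polynomials.\<close>

lemma pullback_T_ideal:
  assumes "T_ideal Q J"
  shows "T_ideal (G d) {f \<in> G_carrier d. cs f \<in> J}"
proof -
  have J: "subspace_of Q J" "\<And>X Y. X \<in> J \<Longrightarrow> Y \<in> carrier Q \<Longrightarrow> mult Q Y X \<in> J \<and> mult Q X Y \<in> J"
    "\<And>\<psi> X. endomorphism_of Q \<psi> \<Longrightarrow> X \<in> J \<Longrightarrow> \<psi> X \<in> J"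
    using assms unfolding T_ideal_def ideal_of_def by blast+
  have "gmul g f \<in> {f \<in> G_carrier d. cs f \<in> J}" "gmul f g \<in> {f \<in> G_carrier d. cs f \<in> J}"
    if "f \<in> {f \<in> G_carrier d. cs f \<in> J}" "g \<in> G_carrier d" for f g
    using that J(2)[of "cs f" "cs g"] by (simp_all add: carrier_Q mult_Q gmul_closed)
  moreover have "\<phi> f \<in> {f \<in> G_carrier d. cs f \<in> J}"
    if \<phi>: "endomorphism_of (G d) \<phi>" and f: "f \<in> {f \<in> G_carrier d. cs f \<in> J}" for \<phi> f
  proof -
    obtain \<psi> where \<psi>: "endomorphism_of Q \<psi>" "\<forall>f\<in>G_carrier d. \<psi> (cs f) = cs (\<phi> f)"
      using factor_endomorphism[OF \<phi>] by metis
    have "\<phi> f \<in> G_carrier d"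
      using \<phi> f unfolding endomorphism_of_def G_def by simp
    with J(3)[OF \<psi>(1), of "cs f"] \<psi>(2) f show ?thesis by simp
  qed
  moreover have "carrier (G d) = (G_carrier d :: 'k galg set)" "mult (G d) = (gmul :: 'k galg \<Rightarrow> _)"
    by (simp_all add: G_def)
  ultimately show ?thesis
    unfolding T_ideal_def ideal_of_def image_subset_iff
    using pullback_subspace(1)[OF J(1)] by (intro conjI ballI allI impI) simp_all
qed

text \<open>The T-ideal is mapped into itself by the action; the action of the inverse matrix shows
  that the image is the whole coset.\<close>

lemma gl_act_cs:
  assumes g: "g \<in> GL d" and f: "f \<in> G_carrier d"
  shows "gl_act d g ` cs f = cs (gl_act d g f)"
proof -
  from g obtain h where "\<forall>i\<in>{1..d}. \<forall>j\<in>{1..d}.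
      (\<Sum>k=1..d. g i k * h k j) = (if i = j then 1 else 0) \<and>
      (\<Sum>k=1..d. h i k * g k j) = (if i = j then 1 else 0)"
    unfolding GL_def by blast
  then have inv: "gl_act d g (gl_act d h x) = x" if "x \<in> G_carrier d" for x
    using that by (intro gl_act_inverse) auto
  have eq: "gl_act d g x - gl_act d g f = gl_act d g (x - f)" for x
    using gl_act_add[of d g "x - f" f] by simp
  show ?thesis
  proof (intro equalityI subsetI)
    fix y assume "y \<in> gl_act d g ` cs f"
    then obtain x where "y = gl_act d g x" "x - f \<in> I"
      by (auto simp: mem_cs)
    then show "y \<in> cs (gl_act d g f)"
      using T_ideal_G_D(5)[OF I _ endomorphism_gl_act, of "x - f" g] by (simp add: mem_cs eq)
  next
    fix y assume "y \<in> cs (gl_act d g f)"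
    then have y: "y - gl_act d g f \<in> I"
      by (simp add: mem_cs)
    \<comment> \<open>The preimage of y: the inverse carries the error term back into the ideal, and
      \<open>f\<close> is added.\<close>
    define x where "x = gl_act d h (y - gl_act d g f) + f"
    have "x \<in> cs f"
      using T_ideal_G_D(5)[OF I y endomorphism_gl_act, of h] by (simp add: mem_cs x_def)
    moreover have "gl_act d g x = y"
      using inv[OF I_closed(4)[OF y]] by (simp add: x_def gl_act_add)
    ultimately show "y \<in> gl_act d g ` cs f"
      by blast
  qed
qed

end

section \<open>Consequences and generated submodules as full homogeneous components\<close>

lemma consequences_eq_GU_comp:
  fixes \<alpha>\<^sub>1 \<alpha>\<^sub>2 :: "'k::field_char_0"
  assumes "d \<ge> 1" "f \<in> G_carrier d"
    and *: "\<And>J. T_ideal (G d) J \<Longrightarrow> U_ideal d \<alpha>\<^sub>1 \<alpha>\<^sub>2 \<subseteq> J \<Longrightarrow> f \<in> J \<Longrightarrow> G_comp d m \<subseteq> J"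
  shows "consequences d \<alpha>\<^sub>1 \<alpha>\<^sub>2 m (img d \<alpha>\<^sub>1 \<alpha>\<^sub>2 f) = GU_comp d \<alpha>\<^sub>1 \<alpha>\<^sub>2 m"
proof -
  interpret T_ideal_factor d "U_ideal d \<alpha>\<^sub>1 \<alpha>\<^sub>2"
    by unfold_locales (rule T_ideal_U_ideal[OF assms(1)])
  \<comment> \<open>Consequences lie in the component by definition. Conversely, a T-ideal
    \<open>J\<close> of the factor algebra containing the coset of \<open>f\<close> is pulled back
    to \<open>G d\<close>, where the hypothesis applies.\<close>
  have "cs x \<in> J" if J: "T_ideal Q J" "cs f \<in> J" and x: "x \<in> G_comp d m" for J x
  proof -
    have "subspace_of Q J"
      using J(1) by (simp add: T_ideal_def ideal_of_def)
    from *[OF pullback_T_ideal[OF J(1)] pullback_subspace(2)[OF this]] show ?thesis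
      using J(2) assms(2) x by auto
  qed
  then show ?thesis
    unfolding consequences_def GU_comp_def GU_def img_def T_ideal_gen_def by auto
qed

text \<open>The component itself is a stable subspace containing the list, which bounds the
  generated submodule from above; for the lower bound every competing submodule is pulled back to
  \<open>G d\<close>.\<close>

lemma GL_submodule_gen_eq_GU_comp:
  fixes \<alpha>\<^sub>1 \<alpha>\<^sub>2 :: "'k::field_char_0"
  assumes "d \<ge> 1" "L \<subseteq> G_comp d m"
    and *: "\<And>M. subspace_of (G d) M \<Longrightarrow> U_ideal d \<alpha>\<^sub>1 \<alpha>\<^sub>2 \<subseteq> M \<Longrightarrow>
      (\<And>g f. g \<in> GL d \<Longrightarrow> f \<in> M \<Longrightarrow> gl_act d g f \<in> M) \<Longrightarrow> L \<subseteq> M \<Longrightarrow> G_comp d m \<subseteq> M"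
  shows "GL_submodule_gen d \<alpha>\<^sub>1 \<alpha>\<^sub>2 (img d \<alpha>\<^sub>1 \<alpha>\<^sub>2 ` L) = GU_comp d \<alpha>\<^sub>1 \<alpha>\<^sub>2 m"
proof -
  interpret T_ideal_factor d "U_ideal d \<alpha>\<^sub>1 \<alpha>\<^sub>2"
    by unfold_locales (rule T_ideal_U_ideal[OF assms(1)])
  have comp: "G_comp d m \<subseteq> G_carrier d"
    by (auto simp: G_comp_def)
  have lower: "cs x \<in> M" if M: "subspace_of Q M" "\<forall>g\<in>GL d. \<forall>X\<in>M. gl_act d g ` X \<in> M" "cs ` L \<subseteq> M"
    and x: "x \<in> G_comp d m" for M x
  proof -
    have "gl_act d g f \<in> {f \<in> G_carrier d. cs f \<in> M}"
      if "g \<in> GL d" "f \<in> {f \<in> G_carrier d. cs f \<in> M}" for g f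
      using bspec[OF bspec[OF M(2) that(1)], of "cs f"] that gl_act_closed[of f d g] gl_act_cs[of g f]
      by simp
    from *[OF pullback_subspace[OF M(1)] this] show ?thesis
      using M(3) assms(2) comp x by blast
  qed
  have stable: "gl_act d g ` X \<in> cs ` G_comp d m" if "g \<in> GL d" "X \<in> cs ` G_comp d m" for g X
  proof -
    from that(2) obtain f where f: "f \<in> G_comp d m" "X = cs f" by (rule imageE)
    then show ?thesis
      using gl_act_cs[OF that(1) subsetD[OF comp f(1)]] gl_act_G_comp[OF f(1), of g] by simp
  qed
  have subspace: "subspace_of Q (cs ` G_comp d m)"
    by (rule image_subspace[OF subspace_G_comp])
  show ?thesis
    unfolding GL_submodule_gen_def GU_comp_def GU_def img_def
  proof (rule equalityI)
    show "\<Inter>{M. subspace_of Q M \<and> (\<forall>g\<in>GL d. \<forall>X\<in>M. gl_act d g ` X \<in> M) \<and> cs ` L \<subseteq> M} \<subseteq> cs ` G_comp d m"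
      using stable subspace image_mono[OF assms(2), of cs] by (intro Inter_lower) simp
    show "cs ` G_comp d m \<subseteq> \<Inter>{M. subspace_of Q M \<and> (\<forall>g\<in>GL d. \<forall>X\<in>M. gl_act d g ` X \<in> M) \<and> cs ` L \<subseteq> M}"
      using lower by (intro Inter_greatest image_subsetI) simp
  qed
qed

text \<open>The whole component of degree 4 is zero in the factor algebra, so \<open>X\<close> may
  be arbitrary; zero itself belongs to every T-ideal.\<close>

lemma consequences_degree_4:
  fixes \<alpha>\<^sub>1 \<alpha>\<^sub>2 :: "'k::field_char_0"
  assumes "d \<ge> 1" "\<alpha>\<^sub>1 \<noteq> 0" "\<alpha>\<^sub>2 \<noteq> 0" "\<alpha>\<^sub>1 + \<alpha>\<^sub>2 \<noteq> 0" "\<alpha>\<^sub>1 \<noteq> \<alpha>\<^sub>2"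
  shows "consequences d \<alpha>\<^sub>1 \<alpha>\<^sub>2 4 X = {zero (GU d \<alpha>\<^sub>1 \<alpha>\<^sub>2)}"
proof -
  interpret T_ideal_factor d "U_ideal d \<alpha>\<^sub>1 \<alpha>\<^sub>2"
    by unfold_locales (rule T_ideal_U_ideal[OF assms(1)])
  have "cs f = U_ideal d \<alpha>\<^sub>1 \<alpha>\<^sub>2" if "f \<in> G_comp d 4" for f
    using U_ideal_degree_4[OF assms] that by (intro cs_eq_I) auto
  moreover have "(0 :: 'k galg) \<in> G_comp d 4"
    by (rule subspace_G_D(1)[OF subspace_G_comp])
  ultimately have "GU_comp d \<alpha>\<^sub>1 \<alpha>\<^sub>2 4 = {zero Q}"
    unfolding GU_comp_def img_def zero_Q by (intro equalityI image_subsetI) (auto intro!: image_eqI[of _ _ 0])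
  moreover have "zero Q \<in> T_ideal_gen Q S" for S
    unfolding T_ideal_gen_def T_ideal_iff by blast
  ultimately show ?thesis
    unfolding consequences_def GU_def by blast
qed

section \<open>The listed vectors and the assembly of the statement\<close>

lemma pol_in_G_comp:
  "n \<noteq> 1 \<Longrightarrow> pol p \<in> G_comp d n \<longleftrightarrow> p \<in> monomials_in d True True \<and> p \<in> homogeneous n"
  by (simp add: G_comp_iff) (simp add: pol_def)

lemma monomial_in_G_comp:
  assumes "{i, j} \<subseteq> {1..d}"
  shows "pol (yv i * zv j) \<in> G_comp d 2"
    and "k \<in> {1..d} \<Longrightarrow> pol (yv k * (yv i * zv j)) \<in> G_comp d 3"
    and "k \<in> {1..d} \<Longrightarrow> pol (yv i * zv j * zv k) \<in> G_comp d 3"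
proof -
  have yz: "yv i * zv j \<in> monomials_in d True True" "yv i * zv j \<in> homogeneous 2"
    using yz_in_monomials[of i d j] homogeneous_mult[OF homogeneous_yv homogeneous_zv, of i j] assms
    by (auto simp: numeral_2_eq_2)
  then show "pol (yv i * zv j) \<in> G_comp d 2"
    by (simp add: pol_in_G_comp)
  show "pol (yv k * (yv i * zv j)) \<in> G_comp d 3" "pol (yv i * zv j * zv k) \<in> G_comp d 3" if "k \<in> {1..d}"
    using monomials_in_mult[OF monomials_in_yv[OF that] yz(1)] monomials_in_mult[OF yz(1) monomials_in_zv[OF that]]
      homogeneous_mult[OF homogeneous_yv yz(2), of k] homogeneous_mult[OF yz(2) homogeneous_zv, of k]
    by (simp_all add: pol_in_G_comp numeral_3_eq_3)
qed

theorem theorem3p7: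
  fixes \<alpha>\<^sub>1 \<alpha>\<^sub>2 :: "'k::field_char_0" and d :: nat
  assumes "d \<ge> 2"
    and "\<alpha>\<^sub>1 * \<alpha>\<^sub>2 * (\<alpha>\<^sub>1 + \<alpha>\<^sub>2) * (\<alpha>\<^sub>1 - \<alpha>\<^sub>2) \<noteq> 0"
  shows "consequences_equivalent_to d \<alpha>\<^sub>1 \<alpha>\<^sub>2 2 (gen 1) {w1 2 1, w2 1 1 0} \<and>
    consequences_equivalent_to d \<alpha>\<^sub>1 \<alpha>\<^sub>2 3 (w1 2 1) {w1 3 2, w2 2 1 1, w2 2 1 0} \<and>
    consequences_equivalent_to d \<alpha>\<^sub>1 \<alpha>\<^sub>2 3 (w2 1 1 0) {w1 3 2, w2 2 1 1, w2 2 1 0} \<and>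
    (\<forall>n\<in>{1, 2}. \<forall>f\<in>GU_comp d \<alpha>\<^sub>1 \<alpha>\<^sub>2 n. f \<noteq> zero (GU d \<alpha>\<^sub>1 \<alpha>\<^sub>2) \<longrightarrow>
       consequences d \<alpha>\<^sub>1 \<alpha>\<^sub>2 (n + 1) f = GU_comp d \<alpha>\<^sub>1 \<alpha>\<^sub>2 (n + 1)) \<and>
    consequences d \<alpha>\<^sub>1 \<alpha>\<^sub>2 4 (img d \<alpha>\<^sub>1 \<alpha>\<^sub>2 (w1 3 2)) = {zero (GU d \<alpha>\<^sub>1 \<alpha>\<^sub>2)} \<and>
    (\<forall>\<beta>\<^sub>1 \<beta>\<^sub>2. (\<beta>\<^sub>1, \<beta>\<^sub>2) \<noteq> (0, 0) \<longrightarrow>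
       consequences d \<alpha>\<^sub>1 \<alpha>\<^sub>2 4
         (img d \<alpha>\<^sub>1 \<alpha>\<^sub>2 (gscale \<beta>\<^sub>1 (w2 2 1 1) + gscale \<beta>\<^sub>2 (w2 2 1 0))) =
       {zero (GU d \<alpha>\<^sub>1 \<alpha>\<^sub>2)})"
proof -
  have \<alpha>: "\<alpha>\<^sub>1 \<noteq> 0" "\<alpha>\<^sub>2 \<noteq> 0" "\<alpha>\<^sub>1 + \<alpha>\<^sub>2 \<noteq> 0" "\<alpha>\<^sub>1 \<noteq> \<alpha>\<^sub>2"
    using assms(2) by auto
  have d: "1 \<le> d" "1 \<in> {1..d}" "2 \<in> {1..d}"
    using assms(1) by auto
  interpret T_ideal_factor d "U_ideal d \<alpha>\<^sub>1 \<alpha>\<^sub>2"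
    by unfold_locales (rule T_ideal_U_ideal[OF d(1)])
  have w: "w1 2 1 = pol (yv 1 * zv 1 :: 'k yz_poly)"
    "w2 1 1 0 = pol (yv 1 * zv 2 - yv 2 * zv 1 :: 'k yz_poly)"
    "w1 3 2 = pol (yv 1 * yv 1 * zv 1 :: 'k yz_poly)"
    "w2 2 1 1 = pol (yv 1 * (yv 1 * zv 2 - yv 2 * zv 1) :: 'k yz_poly)"
    "w2 2 1 0 = pol ((yv 1 * zv 2 - yv 2 * zv 1) * zv 1 :: 'k yz_poly)"
    by (simp_all add: w1_def w2_def power2_eq_square)
  have pol_diff: "pol (p - q) = pol p - pol q" for p q :: "'k yz_poly"
    by (simp add: pol_def)
  have diff: "f - g \<in> G_comp d n" if "f \<in> G_comp d n" "g \<in> G_comp d n" for n and f g :: "'k galg"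
    using that subspace_G_D(2)[OF subspace_G_comp, of f d n "- g"] subspace_G_uminus[OF subspace_G_comp, of g d n]
    by simp
  have w_comp: "{w1 2 1, w2 1 1 0} \<subseteq> (G_comp d 2 :: 'k galg set)"
    "{w1 3 2, w2 2 1 1, w2 2 1 0} \<subseteq> (G_comp d 3 :: 'k galg set)"
    unfolding w insert_subset left_diff_distrib right_diff_distrib pol_diff mult.assoc[of "yv 1" "yv 1"]
    using d by (auto intro!: diff monomial_in_G_comp)
  \<comment> \<open>Proved for every nonzero form of degree 1 or 2, this serves (i) to (iii) and
    also the claim about arbitrary identities of these degrees.\<close>
  have conseq: "consequences d \<alpha>\<^sub>1 \<alpha>\<^sub>2 (n + 1) (img d \<alpha>\<^sub>1 \<alpha>\<^sub>2 f) = GU_comp d \<alpha>\<^sub>1 \<alpha>\<^sub>2 (n + 1)"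
    if n: "n \<in> {1, 2}" and f: "f \<in> G_comp d n" "f \<noteq> 0" for n f
  proof (rule consequences_eq_GU_comp[OF d(1)])
    show "f \<in> G_carrier d"
      using f(1) by (simp add: G_comp_iff)
    show "G_comp d (n + 1) \<subseteq> J"
      if "T_ideal (G d) J" "U_ideal d \<alpha>\<^sub>1 \<alpha>\<^sub>2 \<subseteq> J" "f \<in> J" for J
      using n f T_ideal_degree_1[OF that(1,3)] T_ideal_degree_2[OF assms(1) that(1,2) \<alpha>(3) that(3)]
      by (auto simp: numeral_2_eq_2 numeral_3_eq_3)
  qed
  have gl2: "GL_submodule_gen d \<alpha>\<^sub>1 \<alpha>\<^sub>2 (img d \<alpha>\<^sub>1 \<alpha>\<^sub>2 ` {w1 2 1, w2 1 1 0}) = GU_comp d \<alpha>\<^sub>1 \<alpha>\<^sub>2 2"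
  proof (rule GL_submodule_gen_eq_GU_comp[OF d(1) w_comp(1)])
    fix M :: "'k galg set"
    assume "subspace_of (G d) M" "\<And>g f. g \<in> GL d \<Longrightarrow> f \<in> M \<Longrightarrow> gl_act d g f \<in> M" "{w1 2 1, w2 1 1 0} \<subseteq> M"
    then show "G_comp d 2 \<subseteq> M"
      unfolding w by (intro GL_stable_degree_2[OF assms(1)]) simp_all
  qed
  have gl3: "GL_submodule_gen d \<alpha>\<^sub>1 \<alpha>\<^sub>2 (img d \<alpha>\<^sub>1 \<alpha>\<^sub>2 ` {w1 3 2, w2 2 1 1, w2 2 1 0}) = GU_comp d \<alpha>\<^sub>1 \<alpha>\<^sub>2 3"
  proof (rule GL_submodule_gen_eq_GU_comp[OF d(1) w_comp(2)])
    fix M :: "'k galg set"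
    assume "subspace_of (G d) M" "U_ideal d \<alpha>\<^sub>1 \<alpha>\<^sub>2 \<subseteq> M"
      "\<And>g f. g \<in> GL d \<Longrightarrow> f \<in> M \<Longrightarrow> gl_act d g f \<in> M" "{w1 3 2, w2 2 1 1, w2 2 1 0} \<subseteq> M"
    then show "G_comp d 3 \<subseteq> M"
      unfolding w by (intro GL_stable_degree_3[OF assms(1) _ _ _ \<alpha>(2)]) simp_all
  qed
  have "Poly_Mapping.lookup (yv 1 * zv 1 :: 'k yz_poly)
      (Poly_Mapping.single 1 1, Poly_Mapping.single 1 1) \<noteq> 0"
    by (simp add: yv_def zv_def mult_single)
  then have nz1: "w1 2 1 \<noteq> (0 :: 'k galg)"
    by (auto simp: w[simplified] pol_def zero_prod_def)
  have "Poly_Mapping.single 2 (1::nat) \<noteq> Poly_Mapping.single (1::nat) 1"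
    by (auto dest: arg_cong[of _ _ Poly_Mapping.keys])
  \<comment> \<open>The coefficient of y_1 z_2 is 1, since y_2 z_1 is a different monomial.\<close>
  then have "Poly_Mapping.lookup (yv 1 * zv 2 - yv 2 * zv 1 :: 'k yz_poly)
      (Poly_Mapping.single 1 1, Poly_Mapping.single 2 1) \<noteq> 0"
    by (simp add: yv_def zv_def mult_single lookup_minus lookup_single when_def)
  then have nz2: "w2 1 1 0 \<noteq> (0 :: 'k galg)"
    by (auto simp: w[simplified] pol_def zero_prod_def)
  have "Poly_Mapping.lookup (fst (gen 1 :: 'k galg)) 1 \<noteq> 0"
    by (simp add: gen_def)
  then have nz0: "gen 1 \<noteq> (0 :: 'k galg)"
    by auto
  have gen1: "gen 1 \<in> G_comp d 1"
    using d by (auto simp: gen_def G_comp_def G_carrier_def)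
  have "consequences_equivalent_to d \<alpha>\<^sub>1 \<alpha>\<^sub>2 2 (gen 1) {w1 2 1, w2 1 1 0}"
    unfolding consequences_equivalent_to_def gl2
    using conseq[of 1, OF _ gen1 nz0] by (simp add: numeral_2_eq_2)
  moreover have "consequences_equivalent_to d \<alpha>\<^sub>1 \<alpha>\<^sub>2 3 (w1 2 1) {w1 3 2, w2 2 1 1, w2 2 1 0}"
    "consequences_equivalent_to d \<alpha>\<^sub>1 \<alpha>\<^sub>2 3 (w2 1 1 0) {w1 3 2, w2 2 1 1, w2 2 1 0}"
    using conseq[of 2 "w1 2 1"] conseq[of 2 "w2 1 1 0"] w_comp(1) nz1 nz2
    unfolding consequences_equivalent_to_def gl3 by simp_all
  moreover have "consequences d \<alpha>\<^sub>1 \<alpha>\<^sub>2 (n + 1) X = GU_comp d \<alpha>\<^sub>1 \<alpha>\<^sub>2 (n + 1)"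
    if "n \<in> {1, 2}" "X \<in> GU_comp d \<alpha>\<^sub>1 \<alpha>\<^sub>2 n" "X \<noteq> zero (GU d \<alpha>\<^sub>1 \<alpha>\<^sub>2)" for n X
  proof -
    from that(2) obtain f where f: "f \<in> G_comp d n" "X = img d \<alpha>\<^sub>1 \<alpha>\<^sub>2 f"
      unfolding GU_comp_def by blast
    \<comment> \<open>A nonzero coset has a nonzero representative, so the result for
      \<open>G d\<close> applies to it.\<close>
    with that(3) have "f \<noteq> 0"
      using cs_eq_I[OF I_closed(1)] by (auto simp: img_def GU_def zero_Q)
    with conseq[OF that(1) f(1)] f(2) show ?thesis by simp
  qed
  ultimately show ?thesis
    using consequences_degree_4[OF d(1) \<alpha>] by simp
qed

end
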